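(* Let $J:\mathbb{R}^n\to\mathbb{C}$ satisfy $\int_{\mathbb{R}^n}|J(x)|\,dx=1$ and $J\in L^1(\mathbb{R}^n)\cap L^{1+\varepsilon_0}(\mathbb{R}^n)$ for some $0<\varepsilon_0\leq\infty$. If $u_0\in L^1(\mathbb{R}^n)\cap L^\infty(\mathbb{R}^n)$, then the solution $u(t)$ of $$\partial_tu(x,t)=\int_{\mathbb{R}^n}J(x-y)u(y,t)\,dy-u(x,t),\quad (x,t)\in\mathbb{R}^n\times(0,\infty),$$ with initial value $u_0$ satisfies, for some constants $C,t_0>0$, $$\|u(t)\|_{L^\infty}\leq Ct^{-n/2}\quad\text{for all } t\geq t_0 .$$ Moreover, for each $1\leq q\leq\infty$, there is a constant $C>0$ independent of $q$ such that $$\|u(t)\|_{L^q}\leq Ct^{-\frac{n}{2}(1-\frac{1}{q})}\quad\text{for all } t\geq t_0.$$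
   Context: By definition, the solution of $\partial_tu=\mathcal{J}u-\chi_0u$ with initial value $u_0$, where $\mathcal{J}u=J\ast u$, is $u(t)=e^{-\chi_0t}\sum_{k=0}^\infty\frac{t^k}{k!}\mathcal{J}^ku_0$, with $\mathcal{J}^k$ the $k$-fold composition of $\mathcal{J}$; here $\chi_0=1$. When $\varepsilon_0=\infty$, $L^{1+\varepsilon_0}=L^\infty$. *)

theory Defs
  imports "HOL-Probability.Essential_Supremum"
begin

text \<open>
  The \<open>L\<^sup>q\<close> norm for \<open>0 < q \<le> \<infinity>\<close>, with values in \<^typ>\<open>ennreal\<close>. As for \<^const>\<open>esssup\<close>, a
  non-measurable function has norm \<open>\<infinity>\<close>, so that a finite norm means membership in \<open>L\<^sup>q\<close>
  and an upper bound on the norm includes measurability.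
\<close>

definition Lq_norm :: "'a measure \<Rightarrow> ennreal \<Rightarrow> ('a \<Rightarrow> 'b::real_normed_vector) \<Rightarrow> ennreal" where
  "Lq_norm M q f =
     (if f \<notin> borel_measurable M then \<infinity>
      else if q = \<infinity> then esssup M (\<lambda>x. ennreal (norm (f x)))
      else (let I = (\<integral>\<^sup>+x. ennreal (norm (f x) powr enn2real q) \<partial>M)
            in if I = \<infinity> then \<infinity> else ennreal (enn2real I powr (1 / enn2real q))))"

definition Lq_space :: "'a measure \<Rightarrow> ennreal \<Rightarrow> ('a \<Rightarrow> 'b::real_normed_vector) set" where
  "Lq_space M q = {f. Lq_norm M q f < \<infinity>}"

definition conv_op ::
    "('a::euclidean_space \<Rightarrow> complex) \<Rightarrow> ('a \<Rightarrow> complex) \<Rightarrow> 'a \<Rightarrow> complex" where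
  "conv_op J u = (\<lambda>x. LINT y|lebesgue. J (x - y) * u y)"

text \<open>
  The solution of \<open>\<partial>\<^sub>t u = \<J> u - c u\<close> where \<open>\<J> = conv_op J\<close>, \<open>u(0) = u\<^sub>0\<close>, is defined by the exponential
  series. The series is taken pointwise in \<open>x\<close>: for \<open>J \<in> L\<^sup>1\<close> and \<open>u\<^sub>0 \<in> L\<^sup>1 \<inter> L\<^sup>\<infinity>\<close> every convolution
  integral converges absolutely, with \<open>|(\<J>\<^sup>k u\<^sub>0)(x)| \<le> (\<integral>|J|)\<^sup>k \<parallel>u\<^sub>0\<parallel>\<^sub>\<infinity>\<close> for every \<open>x\<close> if \<open>k \<ge> 1\<close>, so
  the series converges absolutely at every \<open>x\<close>. It also converges in every \<open>L\<^sup>q\<close>, \<open>1 \<le> q \<le> \<infinity>\<close>, to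
  the same function.
\<close>

definition nonlocal_solution ::
    "real \<Rightarrow> ('a::euclidean_space \<Rightarrow> complex) \<Rightarrow> ('a \<Rightarrow> complex) \<Rightarrow> real \<Rightarrow> 'a \<Rightarrow> complex" where
  "nonlocal_solution c J u0 t = (\<lambda>x.
     complex_of_real (exp (- c * t)) *
       (\<Sum>k. complex_of_real (t ^ k / fact k) * (conv_op J ^^ k) u0 x))"

end

theory Submission
  imports Defs
begin

text \<open>
  Replacing \<open>J\<close> and \<open>u\<^sub>0\<close> by their absolute values can only enlarge every term of the exponential
  series. So \<open>|u(t)|\<close> is at most \<open>e\<^sup>-\<^sup>t \<Sum>\<^sub>k t\<^sup>k/k! K\<^sup>*\<^sup>k * f\<close> with \<open>K = |J|\<close> a probability density and
  \<open>f = |u\<^sub>0|\<close>, and the theorem becomes a statement about a random walk: its density spreads out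
  at the rate \<open>k\<^sup>-\<^sup>n\<^sup>/\<^sup>2\<close>, and averaging over the Poisson number \<open>k\<close> of steps up to time \<open>t\<close> turns this
  into \<open>t\<^sup>-\<^sup>n\<^sup>/\<^sup>2\<close>. All estimates use functions with values in \<^typ>\<open>ennreal\<close>, so that convolutions
  always exist and Tonelli's theorem gives commutativity and associativity.

  The rate \<open>k\<^sup>-\<^sup>n\<^sup>/\<^sup>2\<close> comes from comparison with a walk whose density can be computed; Fourier
  analysis is avoided. The density \<open>K * K\<close> of two steps is bounded below by a constant on a ball
  (\<open>nnconv_self_positive_on_ball\<close>, an argument in the manner of Steinhaus), hence it dominates a
  multiple \<open>U\<close> of the indicator of a cube of side \<open>2h\<close>. Such an indicator is the convolution of
  the indicator of a cube of side \<open>h\<close> with \<open>\<Prod>\<^sub>i (\<delta>\<^sub>0 + \<delta>\<^bsub>h e\<^sub>i\<^esub>)\<close>, so \<open>j\<close> steps with density \<open>U\<close> contain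
  \<open>n\<close> independent binomial walks on the lattice of width \<open>h\<close>. All binomial coefficients of order
  \<open>j\<close> are at most \<open>2\<^sup>j / \<surd>(j + 1)\<close>, and the lattice translates of a small cube do not overlap; this
  gives the factor \<open>(j + 1)\<^sup>-\<^sup>n\<^sup>/\<^sup>2\<close> for the \<open>j\<close>th power of \<open>U\<close> (\<open>nnconv_box_bump_power_le\<close>).
  With \<open>V = K * K - U\<close> and \<open>\<theta> = \<integral> U\<close>, the expansion of \<open>(U + V)\<^sup>N\<close> averages this factor over a
  binomial law with parameters \<open>N\<close> and \<open>\<theta>\<close>, which preserves the rate
  (\<open>nnconv_power_decay_if_bump\<close>, \<open>nnconv_power_decay\<close>). The single term with \<open>j = 0\<close> is controlled by the bound on \<open>f\<close>.

  Since convolution with \<open>K\<close> preserves the integral, \<open>\<parallel>u(t)\<parallel>\<^sub>1 \<le> \<parallel>u\<^sub>0\<parallel>\<^sub>1\<close>, and interpolation between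
  \<open>L\<^sup>1\<close> and \<open>L\<^sup>\<infinity>\<close> yields every \<open>L\<^sup>q\<close> bound with one constant.
\<close>

section \<open>Convolution of nonnegative functions\<close>

definition nnconv :: "('a::euclidean_space \<Rightarrow> ennreal) \<Rightarrow> ('a \<Rightarrow> ennreal) \<Rightarrow> 'a \<Rightarrow> ennreal" where
  "nnconv K f x = (\<integral>\<^sup>+y. K (x - y) * f y \<partial>lborel)"

lemma nn_integral_lborel_reflect:
  fixes f :: "'a::euclidean_space \<Rightarrow> ennreal"
  assumes [measurable]: "f \<in> borel_measurable borel"
  shows "(\<integral>\<^sup>+y. f (a - y) \<partial>lborel) = (\<integral>\<^sup>+y. f y \<partial>lborel)"
  by (subst (2) lborel_affine[of "- 1" a]) (simp_all add: nn_integral_density nn_integral_distr)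

lemma nn_integral_lborel_shift:
  fixes f :: "'a::euclidean_space \<Rightarrow> ennreal"
  assumes [measurable]: "f \<in> borel_measurable borel"
  shows "(\<integral>\<^sup>+y. f (y - a) \<partial>lborel) = (\<integral>\<^sup>+y. f y \<partial>lborel)"
  by (subst (2) lborel_affine[of 1 "- a"]) (simp_all add: nn_integral_density nn_integral_distr)

lemma nnconv_measurable [measurable]:
  assumes [measurable]: "K \<in> borel_measurable borel" "f \<in> borel_measurable borel"
  shows "nnconv K f \<in> borel_measurable borel"
  unfolding nnconv_def by measurable

lemma nnconv_commute:
  assumes [measurable]: "K \<in> borel_measurable borel" "f \<in> borel_measurable borel"
  shows "nnconv K f = nnconv f K"
proof
  fix x
  show "nnconv K f x = nnconv f K x"
    using nn_integral_lborel_reflect[of "\<lambda>y. K (x - y) * f y" x]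
    by (simp add: nnconv_def mult.commute)
qed

lemma nnconv_assoc:
  assumes [measurable]: "K \<in> borel_measurable borel" "L \<in> borel_measurable borel"
    "f \<in> borel_measurable borel"
  shows "nnconv K (nnconv L f) = nnconv (nnconv K L) f"
proof
  fix x
  have "nnconv K (nnconv L f) x = (\<integral>\<^sup>+y. \<integral>\<^sup>+z. K (x - y) * (L (y - z) * f z) \<partial>lborel \<partial>lborel)"
    unfolding nnconv_def by (simp add: nn_integral_cmult)
  also have "\<dots> = (\<integral>\<^sup>+z. \<integral>\<^sup>+y. K (x - y) * (L (y - z) * f z) \<partial>lborel \<partial>lborel)"
    by (rule lborel_pair.Fubini') measurable
  also have "\<dots> = (\<integral>\<^sup>+z. (\<integral>\<^sup>+y. K (x - y) * L (y - z) \<partial>lborel) * f z \<partial>lborel)"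
    by (simp add: nn_integral_multc flip: mult.assoc)
  also have "\<dots> = (\<integral>\<^sup>+z. nnconv K L (x - z) * f z \<partial>lborel)"
  proof (intro nn_integral_cong)
    fix z
    show "(\<integral>\<^sup>+y. K (x - y) * L (y - z) \<partial>lborel) * f z = nnconv K L (x - z) * f z"
      using nn_integral_lborel_shift[of "\<lambda>y. K ((x - z) - y) * L y" z]
      by (simp add: nnconv_def algebra_simps)
  qed
  finally show "nnconv K (nnconv L f) x = nnconv (nnconv K L) f x"
    by (simp add: nnconv_def)
qed

lemma nnconv_left_commute:
  assumes [measurable]: "K \<in> borel_measurable borel" "L \<in> borel_measurable borel"
    "f \<in> borel_measurable borel"
  shows "nnconv K (nnconv L f) = nnconv L (nnconv K f)"
  by (simp add: nnconv_assoc nnconv_commute[of K L])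

lemma nnconv_add_kernel:
  assumes [measurable]: "K \<in> borel_measurable borel" "L \<in> borel_measurable borel"
    "f \<in> borel_measurable borel"
  shows "nnconv (\<lambda>x. K x + L x) f = (\<lambda>x. nnconv K f x + nnconv L f x)"
  by (simp add: fun_eq_iff nnconv_def nn_integral_add distrib_right)

lemma nnconv_cmult_kernel:
  assumes [measurable]: "K \<in> borel_measurable borel" "f \<in> borel_measurable borel"
  shows "nnconv (\<lambda>x. c * K x) f = (\<lambda>x. c * nnconv K f x)"
  by (simp add: fun_eq_iff nnconv_def nn_integral_cmult mult.assoc)

lemma nnconv_cmult:
  assumes [measurable]: "K \<in> borel_measurable borel" "f \<in> borel_measurable borel"
  shows "nnconv K (\<lambda>x. c * f x) = (\<lambda>x. c * nnconv K f x)"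
  by (simp add: fun_eq_iff nnconv_def nn_integral_cmult mult.left_commute)

lemma nnconv_shift_kernel: "nnconv (\<lambda>x. K (x - a)) f x = nnconv K f (x - a)"
  by (simp add: nnconv_def algebra_simps)

lemma nnconv_shift:
  assumes [measurable]: "K \<in> borel_measurable borel" "f \<in> borel_measurable borel"
  shows "nnconv K (\<lambda>x. f (x - a)) x = nnconv K f (x - a)"
  by (simp add: nnconv_commute[of K] nnconv_shift_kernel)

lemma nn_integral_nnconv:
  assumes [measurable]: "K \<in> borel_measurable borel" "f \<in> borel_measurable borel"
  shows "(\<integral>\<^sup>+x. nnconv K f x \<partial>lborel) = (\<integral>\<^sup>+x. K x \<partial>lborel) * (\<integral>\<^sup>+x. f x \<partial>lborel)"
proof -
  have "(\<integral>\<^sup>+x. nnconv K f x \<partial>lborel) = (\<integral>\<^sup>+y. \<integral>\<^sup>+x. K (x - y) * f y \<partial>lborel \<partial>lborel)"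
    unfolding nnconv_def by (rule lborel_pair.Fubini') measurable
  also have "\<dots> = (\<integral>\<^sup>+y. (\<integral>\<^sup>+x. K x \<partial>lborel) * f y \<partial>lborel)"
    by (simp add: nn_integral_multc nn_integral_lborel_shift)
  finally show ?thesis by (simp add: nn_integral_cmult)
qed

lemma nnconv_mono: "(\<And>x. f x \<le> g x) \<Longrightarrow> nnconv K f x \<le> nnconv K g x"
  unfolding nnconv_def by (intro nn_integral_mono mult_left_mono) auto

lemma nnconv_le_sup:
  assumes [measurable]: "K \<in> borel_measurable borel" and "\<And>x. f x \<le> B"
  shows "nnconv K f x \<le> (\<integral>\<^sup>+x. K x \<partial>lborel) * B"
proof -
  have "nnconv K f x \<le> (\<integral>\<^sup>+y. K (x - y) * B \<partial>lborel)"
    unfolding nnconv_def by (intro nn_integral_mono mult_left_mono assms) auto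
  then show ?thesis by (simp add: nn_integral_multc nn_integral_lborel_reflect)
qed

lemma nnconv_power_measurable [measurable]:
  assumes [measurable]: "K \<in> borel_measurable borel" "f \<in> borel_measurable borel"
  shows "(nnconv K ^^ k) f \<in> borel_measurable borel"
  by (induction k) auto

lemma nn_integral_nnconv_power:
  assumes [measurable]: "K \<in> borel_measurable borel" "f \<in> borel_measurable borel"
  shows "(\<integral>\<^sup>+x. (nnconv K ^^ k) f x \<partial>lborel) = (\<integral>\<^sup>+x. K x \<partial>lborel) ^ k * (\<integral>\<^sup>+x. f x \<partial>lborel)"
  by (induction k) (simp_all add: nn_integral_nnconv mult.assoc)

lemma nnconv_power_le_sup:
  assumes [measurable]: "K \<in> borel_measurable borel" and "\<And>x. f x \<le> B"
  shows "(nnconv K ^^ k) f x \<le> (\<integral>\<^sup>+x. K x \<partial>lborel) ^ k * B"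
proof (induction k arbitrary: x)
  case (Suc k)
  show ?case using nnconv_le_sup[OF assms(1) Suc.IH] by (simp add: mult.assoc)
qed (simp add: assms)

lemma nnconv_power_commute:
  assumes [measurable]: "K \<in> borel_measurable borel" "L \<in> borel_measurable borel"
    "f \<in> borel_measurable borel"
  shows "nnconv L ((nnconv K ^^ j) f) = (nnconv K ^^ j) (nnconv L f)"
  by (induction j) (simp_all add: nnconv_left_commute[of L K])

lemma nnconv_sum:
  assumes [measurable]: "K \<in> borel_measurable borel" "\<And>i. i \<in> I \<Longrightarrow> f i \<in> borel_measurable borel"
  shows "nnconv K (\<lambda>x. \<Sum>i\<in>I. f i x) = (\<lambda>x. \<Sum>i\<in>I. nnconv K (f i) x)"
  by (simp add: fun_eq_iff nnconv_def sum_distrib_left nn_integral_sum)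

section \<open>Self-convolutions are bounded below on a ball\<close>

text \<open>
  The value at \<open>x\<close> is the measure of \<open>T \<inter> (x - T)\<close>. Its integral over \<open>x\<close> is the square of the
  measure of \<open>T\<close>, so it is positive at some \<open>x0\<close>. Moving \<open>x0\<close> by a small \<open>d\<close> costs at most the
  measure of a thin neighbourhood of \<open>T\<close> minus \<open>T\<close>: if \<open>U \<supseteq> T\<close> is open, then \<open>T\<close> and \<open>T - d\<close> lie both
  in \<open>U\<close> and have the same measure.
\<close>

lemma compact_self_conv_positive_on_ball:
  fixes T :: "'a::euclidean_space set"
  assumes "compact T" "emeasure lborel T > 0"
  obtains x0 r e where "0 < r" "0 < e"
    "\<forall>x\<in>ball x0 r. ennreal e \<le> nnconv (indicator T) (indicator T) x"
proof -
  let ?F = "nnconv (indicator T) (indicator T) :: 'a \<Rightarrow> ennreal"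
  have T_borel [measurable]: "T \<in> sets borel" using assms by (simp add: borel_compact)
  have T_fin: "emeasure lborel T < \<infinity>" using assms emeasure_compact_finite by blast
  have F_eq: "?F x = emeasure lborel {y. y \<in> T \<and> x - y \<in> T}" for x
  proof -
    have "?F x = (\<integral>\<^sup>+y. indicator {y. y \<in> T \<and> x - y \<in> T} y \<partial>lborel)"
      unfolding nnconv_def by (intro nn_integral_cong) (auto simp: indicator_def)
    also have "\<dots> = emeasure lborel {y. y \<in> T \<and> x - y \<in> T}" 
      by (rule nn_integral_indicator) measurable
    finally show ?thesis .
  qed
  have "(\<integral>\<^sup>+x. ?F x \<partial>lborel) = emeasure lborel T * emeasure lborel T"
    by (simp add: nn_integral_nnconv)
  with assms(2) have "(\<integral>\<^sup>+x. ?F x \<partial>lborel) \<noteq> 0" by simp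
  then obtain x0 where x0: "?F x0 \<noteq> 0"
    using nn_integral_cong[of lborel ?F "\<lambda>_. 0"] by auto
  have F_fin: "?F x0 < \<infinity>"
    unfolding F_eq by (rule le_less_trans[OF emeasure_mono T_fin]) auto
  \<comment> \<open>half of the value at \<open>x0\<close> is given away to the neighbourhood of \<open>T\<close>\<close>
  define e where "e = enn2real (?F x0) / 2"
  have e: "0 < e" "?F x0 = ennreal e + ennreal e"
  proof -
    have "0 < enn2real (?F x0)" using x0 F_fin by (simp add: enn2real_positive_iff zero_less_iff_neq_zero)
    then show "0 < e" by (simp add: e_def)
    have "?F x0 = ennreal (e + e)" using F_fin by (simp add: e_def)
    then show "?F x0 = ennreal e + ennreal e" using \<open>0 < e\<close> by (metis ennreal_plus less_imp_le)
  qed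
  obtain U where U: "open U" "T \<subseteq> U" "emeasure lborel (U - T) < ennreal e"
    using outer_regular_lborel[OF T_borel e(1)] by blast
  have [measurable]: "U \<in> sets borel" using U by simp
  have "emeasure lborel U = emeasure lborel T + emeasure lborel (U - T)"
    using plus_emeasure[of T lborel "U - T"] U(2) by (simp add: Un_absorb1)
  with T_fin U(3) have U_fin: "emeasure lborel U \<noteq> \<infinity>" 
    by (auto simp: top_unique)
  obtain r where r: "0 < r" "\<And>x y. x \<in> T \<Longrightarrow> y \<in> - U \<Longrightarrow> r \<le> dist x y"
  proof -
    have "closed (- U)" "T \<inter> (- U) = {}" using U by auto
    from separate_compact_closed[OF assms(1) this] show ?thesis using that by blast
  qed
  show thesis
  proof (rule that[OF r(1) e(1)], rule ballI)
    fix x assume "x \<in> ball x0 r"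
    define d where "d = x - x0"
    define T' where "T' = {y. y + d \<in> T}"
    have d: "norm d < r" using \<open>x \<in> ball x0 r\<close> by (simp add: d_def dist_norm norm_minus_commute)
    have [measurable]: "T' \<in> sets borel" unfolding T'_def by measurable
    have "T' \<subseteq> U"
    proof
      fix y assume "y \<in> T'"
      then have "y + d \<in> T" by (simp add: T'_def)
      then show "y \<in> U" using r(2)[of "y + d" y] d by (auto simp: dist_norm)
    qed
    have T'_eq: "emeasure lborel T' = emeasure lborel T"
      using nn_integral_lborel_shift[of "indicator T" "- d"]
      by (simp add: T'_def indicator_def flip: nn_integral_indicator)
    have "emeasure lborel (U - T') = emeasure lborel U - emeasure lborel T'"
      by (rule emeasure_Diff) (use \<open>T' \<subseteq> U\<close> T'_eq T_fin in auto)
    also have "\<dots> = emeasure lborel (U - T)"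
      unfolding T'_eq by (rule emeasure_Diff[symmetric]) (use U T_fin in auto)
    finally have UT': "emeasure lborel (U - T') < ennreal e" using U by simp
    have shifted: "emeasure lborel {y. y \<in> T' \<and> x0 - y \<in> T} = ?F x"
    proof -
      have "emeasure lborel {y. y \<in> T' \<and> x0 - y \<in> T} 
          = (\<integral>\<^sup>+y. indicator {y. y \<in> T' \<and> x0 - y \<in> T} y \<partial>lborel)"
        by (rule nn_integral_indicator[symmetric]) measurable
      also have "\<dots> = (\<integral>\<^sup>+y. indicator {y. y \<in> T \<and> x - y \<in> T} (y - (- d)) \<partial>lborel)"
        by (intro nn_integral_cong) (simp add: indicator_def T'_def d_def algebra_simps)
      also have "\<dots> = (\<integral>\<^sup>+y. indicator {y. y \<in> T \<and> x - y \<in> T} y \<partial>lborel)"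
        by (rule nn_integral_lborel_shift) measurable
      finally show ?thesis by (simp add: F_eq)
    qed
    have "?F x0 \<le> emeasure lborel ({y. y \<in> T' \<and> x0 - y \<in> T} \<union> (U - T'))"
      unfolding F_eq
    proof (rule emeasure_mono)
      show "{y. y \<in> T \<and> x0 - y \<in> T} \<subseteq> {y. y \<in> T' \<and> x0 - y \<in> T} \<union> (U - T')" using U(2) by blast
      show "{y. y \<in> T' \<and> x0 - y \<in> T} \<union> (U - T') \<in> sets lborel" by measurable
    qed
    also have "\<dots> \<le> ?F x + emeasure lborel (U - T')"
      unfolding shifted[symmetric] by (rule emeasure_subadditive; measurable)
    finally have le: "ennreal e + ennreal e \<le> ?F x + emeasure lborel (U - T')" using e by simp
    show "ennreal e \<le> ?F x"
    proof (rule ccontr)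
      assume "\<not> ennreal e \<le> ?F x"
      then have "?F x + emeasure lborel (U - T') < ennreal e + ennreal e"
        using UT' by (intro add_strict_mono) auto
      with le show False by simp
    qed
  qed
qed

text \<open>
  A function with nonzero integral is at least some \<open>b > 0\<close> on a set of positive measure, which may be
  taken compact by inner regularity, so that the case of an indicator applies.
\<close>

lemma nnconv_self_positive_on_ball:
  fixes K :: "'a::euclidean_space \<Rightarrow> ennreal"
  assumes [measurable]: "K \<in> borel_measurable borel" and "(\<integral>\<^sup>+x. K x \<partial>lborel) \<noteq> 0"
  obtains x0 r c where "0 < r" "0 < c" "\<forall>x\<in>ball x0 r. ennreal c \<le> nnconv K K x"
proof -
  define A where "A m = {x. ennreal (inverse (real (Suc m))) \<le> K x} \<inter> cball 0 (real m)" for m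
  have A_borel [measurable]: "A m \<in> sets borel" for m unfolding A_def by measurable
  have "\<exists>m. emeasure lborel (A m) \<noteq> 0"
  proof (rule ccontr)
    assume "\<nexists>m. emeasure lborel (A m) \<noteq> 0"
    then have null: "emeasure lborel (\<Union>m. A m) = 0"
      by (intro emeasure_UN_eq_0) auto
    have "x \<in> (\<Union>m. A m)" if "K x \<noteq> 0" for x
    proof -
      obtain a where a: "0 < a" "ennreal a < K x"
      proof -
        obtain r where r: "0 < r" "r < K x" using \<open>K x \<noteq> 0\<close> dense[of 0 "K x"] by (auto simp: zero_less_iff_neq_zero)
        then have "r < top" using less_le_trans top_greatest by blast
        with r show ?thesis by (intro that[of "enn2real r"]) (auto simp: enn2real_positive_iff)
      qed
      obtain n1 where n1: "inverse (real (Suc n1)) < a" using reals_Archimedean a by blast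
      obtain n2 where n2: "norm x \<le> real n2" using real_arch_simple by blast
      let ?m = "max n1 n2"
      have "inverse (real (Suc ?m)) \<le> inverse (real (Suc n1))"
        by (intro le_imp_inverse_le) auto
      with n1 have "inverse (real (Suc ?m)) \<le> a" by linarith
      then have "ennreal (inverse (real (Suc ?m))) \<le> K x"
        using a(2) by (meson ennreal_leI less_imp_le order_trans)
      then have "x \<in> A ?m" using n2 by (auto simp: A_def)
      then show ?thesis by blast
    qed
    then have "AE x in lborel. K x = 0"
      using null by (intro AE_I[where N="\<Union>m. A m"]) auto
    with assms(2) show False by (simp add: nn_integral_0_iff_AE)
  qed
  then obtain m where m: "emeasure lborel (A m) \<noteq> 0" by blast
  have bnd: "bounded (A m)" unfolding A_def by (auto intro: bounded_subset[OF bounded_cball])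
  have fin: "emeasure lborel (A m) < \<infinity>"
    by (rule le_less_trans[OF emeasure_mono emeasure_lborel_cball_finite[of 0 "real m"]])
       (auto simp: A_def)
  define a where "a = enn2real (emeasure lborel (A m))"
  have a: "0 < a" "emeasure lborel (A m) = ennreal a"
    using m fin by (auto simp: a_def enn2real_positive_iff zero_less_iff_neq_zero)
  obtain T where T: "closed T" "T \<subseteq> A m" "emeasure lebesgue (A m - T) < ennreal a"
  proof -
    have "A m \<in> sets lebesgue" by simp
    then show ?thesis by (rule sets_lebesgue_inner_closed[OF _ a(1)]) (rule that)
  qed
  have "bounded T" by (rule bounded_subset[OF bnd T(2)])
  with T(1) have "compact T" by (simp add: compact_eq_bounded_closed)
  then have [measurable]: "T \<in> sets borel" by (rule borel_compact)
  have "emeasure lborel T \<noteq> 0"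
  proof
    assume T0: "emeasure lborel T = 0"
    have "emeasure lborel (A m) = emeasure lborel T + emeasure lborel (A m - T)"
      using plus_emeasure[of T lborel "A m - T"] T(2) by (simp add: Un_absorb1)
    with T0 T(3) a(2) show False by simp
  qed
  then have "emeasure lborel T > 0" by (simp add: zero_less_iff_neq_zero)
  with \<open>compact T\<close> obtain x0 r e where r: "0 < r" "0 < e"
    "\<forall>x\<in>ball x0 r. ennreal e \<le> nnconv (indicator T) (indicator T) x" by (rule compact_self_conv_positive_on_ball)
  define b where "b = inverse (real (Suc m))"
  have b: "0 < b" by (simp add: b_def)
  have Kb: "ennreal b * indicator T y \<le> K y" for y
    using T(2) by (auto simp: A_def b_def indicator_def)
  have "0 < b * b * e" using b r by simp
  then show thesis
  proof (rule that[OF r(1)], intro ballI)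
    fix x assume x: "x \<in> ball x0 r"
    have "ennreal (b * b * e) = ennreal b * ennreal b * ennreal e"
      using b r by (simp add: ennreal_mult)
    also have "\<dots> \<le> ennreal b * ennreal b * nnconv (indicator T) (indicator T) x"
      by (intro mult_left_mono r(3)[rule_format] x) auto
    also have "\<dots> = (\<integral>\<^sup>+y. (ennreal b * indicator T (x - y)) * (ennreal b * indicator T y) \<partial>lborel)"
      unfolding nnconv_def by (subst nn_integral_cmult[symmetric]) (auto simp: mult_ac)
    also have "\<dots> \<le> nnconv K K x"
      unfolding nnconv_def by (intro nn_integral_mono mult_mono Kb) auto
    finally show "ennreal (b * b * e) \<le> nnconv K K x" .
  qed
qed

section \<open>Convolution powers of the indicator of a cube\<close>

definition shift_sum :: "nat \<Rightarrow> 'a::real_vector \<Rightarrow> ('a \<Rightarrow> ennreal) \<Rightarrow> 'a \<Rightarrow> ennreal" where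
  "shift_sum m a f x = (\<Sum>b\<le>m. f (x - real b *\<^sub>R a))"

text \<open>
  Summation over the translates by the lattice points \<open>h (b\<^sub>1 i\<^sub>1 + b\<^sub>2 i\<^sub>2 + \<dots>)\<close> with \<open>0 \<le> b\<^sub>r \<le> m\<close>, where
  \<open>l = [i\<^sub>1, i\<^sub>2, \<dots>]\<close>. Written as a composition of one-dimensional sums, it can be treated by
  induction on the list of directions.
\<close>

definition grid_sum :: "nat \<Rightarrow> real \<Rightarrow> 'a::real_vector list \<Rightarrow> ('a \<Rightarrow> ennreal) \<Rightarrow> 'a \<Rightarrow> ennreal" where
  "grid_sum m h l = foldr (\<lambda>i. shift_sum m (h *\<^sub>R i)) l"

lemma grid_sum_Nil [simp]: "grid_sum m h [] f = f"
  by (simp add: grid_sum_def)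

lemma grid_sum_Cons [simp]: "grid_sum m h (i # l) f = shift_sum m (h *\<^sub>R i) (grid_sum m h l f)"
  by (simp add: grid_sum_def)

lemma shift_sum_commute: "shift_sum m a (shift_sum k b f) = shift_sum k b (shift_sum m a f)"
proof
  fix x
  show "shift_sum m a (shift_sum k b f) x = shift_sum k b (shift_sum m a f) x"
    unfolding shift_sum_def by (subst sum.swap) (simp add: algebra_simps)
qed

lemma grid_sum_shift_sum_commute:
  "grid_sum m h l (shift_sum k b f) = shift_sum k b (grid_sum m h l f)"
  by (induction l) (simp_all add: shift_sum_commute)

lemma shift_sum_cmult: "shift_sum m a (\<lambda>x. c * f x) = (\<lambda>x. c * shift_sum m a f x)"
  by (simp add: fun_eq_iff shift_sum_def sum_distrib_left)

lemma shift_sum_mono: "(\<And>x. f x \<le> g x) \<Longrightarrow> shift_sum m a f x \<le> shift_sum m a g x"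
  unfolding shift_sum_def by (intro sum_mono)

lemma shift_sum_measurable [measurable]:
  assumes [measurable]: "f \<in> borel_measurable borel"
  shows "shift_sum m (a::'a::euclidean_space) f \<in> borel_measurable borel"
  unfolding shift_sum_def by measurable

lemma grid_sum_measurable [measurable]:
  assumes [measurable]: "f \<in> borel_measurable borel"
  shows "grid_sum m h (l::'a::euclidean_space list) f \<in> borel_measurable borel"
  by (induction l) (auto intro: shift_sum_measurable)

lemma nnconv_shift_sum:
  assumes [measurable]: "K \<in> borel_measurable borel" "f \<in> borel_measurable borel"
  shows "nnconv K (shift_sum m a f) = shift_sum m a (nnconv K f)"
proof
  fix x
  show "nnconv K (shift_sum m a f) x = shift_sum m a (nnconv K f) x"
    unfolding shift_sum_def by (subst nnconv_sum) (simp_all add: nnconv_shift)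
qed

lemma nnconv_grid_sum:
  assumes [measurable]: "K \<in> borel_measurable borel" "f \<in> borel_measurable borel"
  shows "nnconv K (grid_sum m h l f) = grid_sum m h l (nnconv K f)"
  by (induction l) (simp_all add: nnconv_shift_sum)

lemma nnconv_grid_sum_kernel:
  assumes [measurable]: "K \<in> borel_measurable borel" "f \<in> borel_measurable borel"
  shows "nnconv (grid_sum m h l K) f = grid_sum m h l (nnconv K f)"
  by (simp add: nnconv_commute[of _ f] nnconv_grid_sum)

lemma nn_integral_grid_sum:
  fixes f :: "'a::euclidean_space \<Rightarrow> ennreal"
  assumes [measurable]: "f \<in> borel_measurable borel"
  shows "(\<integral>\<^sup>+x. grid_sum m h l f x \<partial>lborel) = of_nat (m + 1) ^ length l * (\<integral>\<^sup>+x. f x \<partial>lborel)"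
proof (induction l)
  case (Cons i l)
  have "(\<integral>\<^sup>+x. grid_sum m h (i # l) f x \<partial>lborel) = (\<Sum>b\<le>m. \<integral>\<^sup>+x. grid_sum m h l f x \<partial>lborel)"
    by (simp add: shift_sum_def nn_integral_sum nn_integral_lborel_shift)
  then show ?case using Cons by (simp add: mult.assoc)
qed simp

text \<open>
  Pascal's rule, summed against a sequence: the induction step of any binomial expansion, also of
  those for operators.
\<close>

lemma sum_binomial_Suc:
  fixes g :: "nat \<Rightarrow> 'b::comm_semiring_1"
  shows "(\<Sum>b\<le>Suc j. of_nat (Suc j choose b) * g b) =
    (\<Sum>b\<le>j. of_nat (j choose b) * g b) + (\<Sum>b\<le>j. of_nat (j choose b) * g (Suc b))"
proof -
  have "(\<Sum>b\<le>Suc j. of_nat (Suc j choose b) * g b) =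
      (\<Sum>b\<le>j. of_nat (j choose b) * g (Suc b)) + (g 0 + (\<Sum>b\<le>j. of_nat (j choose Suc b) * g (Suc b)))"
    by (subst sum.atMost_Suc_shift) (simp add: algebra_simps sum.distrib)
  also have "g 0 + (\<Sum>b\<le>j. of_nat (j choose Suc b) * g (Suc b)) = (\<Sum>b\<le>Suc j. of_nat (j choose b) * g b)"
    by (subst sum.atMost_Suc_shift) (simp del: sum.atMost_Suc)
  also have "\<dots> = (\<Sum>b\<le>j. of_nat (j choose b) * g b)" by (simp add: binomial_eq_0)
  finally show ?thesis by (simp only: add.commute)
qed

lemma shift_sum_1: "shift_sum 1 a f x = f x + f (x - a)"
  by (simp add: shift_sum_def)

lemma shift_sum_1_power:
  "(shift_sum 1 a ^^ j) f x = (\<Sum>b\<le>j. of_nat (j choose b) * f (x - real b *\<^sub>R a))"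
proof (induction j arbitrary: x)
  case (Suc j)
  have "(shift_sum 1 a ^^ Suc j) f x = (shift_sum 1 a ^^ j) f x + (shift_sum 1 a ^^ j) f (x - a)"
    by (simp only: funpow.simps o_apply shift_sum_1)
  also have "\<dots> = (\<Sum>b\<le>j. of_nat (j choose b) * f (x - real b *\<^sub>R a)) +
     (\<Sum>b\<le>j. of_nat (j choose b) * f (x - a - real b *\<^sub>R a))"
    by (simp only: Suc)
  also have "\<dots> = (\<Sum>b\<le>Suc j. of_nat (Suc j choose b) * f (x - real b *\<^sub>R a))"
    by (subst sum_binomial_Suc) (simp add: algebra_simps)
  finally show ?case .
qed simp

text \<open>
  The ratio of consecutive central binomial coefficients is \<open>2 (2m + 1) / (m + 1)\<close>, and
  \<open>(2m + 1) (2m + 3) \<le> (2m + 2)\<^sup>2\<close>.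
\<close>

lemma central_binomial_le: "real ((2 * m) choose m) \<le> 4 ^ m / sqrt (2 * m + 1)"
proof (induction m)
  case (Suc m)
  define X where "X = (2 * Suc m) choose Suc m"
  define Y where "Y = Suc (2 * m) choose m"
  define Z where "Z = (2 * m) choose m"
  have "Suc m * X = Suc (Suc (2*m)) * Y"
    using Suc_times_binomial[of m "Suc (2*m)"] by (simp only: X_def Y_def mult_Suc_right add_2_eq_Suc)
  then have "Suc m * X = Suc m * (2 * Y)" by (simp add: algebra_simps)
  then have XY: "X = 2 * Y" by (simp only: mult_cancel1) simp
  have "Suc m * Y = Suc (2*m) * Z"
    using Suc_times_binomial[of m "2*m"] binomial_symmetric[of m "Suc (2*m)"] by (simp add: Y_def Z_def)
  then have "real (Suc m * Y) = real (Suc (2*m) * Z)" by (simp only:)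
  then have rec: "real X * (m + 1) = 2 * (2 * m + 1) * real Z"
    by (simp add: XY algebra_simps)
  let ?m = "real m"
  have "sqrt (2 * ?m + 3) * sqrt (2 * ?m + 1) = sqrt ((2 * ?m + 3) * (2 * ?m + 1))"
    by (rule real_sqrt_mult[symmetric])
  also have "\<dots> \<le> sqrt ((2 * ?m + 2)^2)"
    by (intro real_sqrt_le_mono) (simp add: power2_eq_square algebra_simps)
  finally have "sqrt (2 * ?m + 3) * sqrt (2 * ?m + 1) \<le> 2 * ?m + 2" by simp
  then have "sqrt (2 * ?m + 1) \<le> (2 * ?m + 2) / sqrt (2 * ?m + 3)"
    by (simp add: pos_le_divide_eq mult.commute)
  then have key: "(2 * ?m + 1) / sqrt (2 * ?m + 1) \<le> (2 * ?m + 2) / sqrt (2 * ?m + 3)"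
    by (simp add: real_div_sqrt)
  have "real X = 2 * (2 * ?m + 1) * real Z / (?m + 1)"
    using rec by (simp add: field_simps)
  also have "\<dots> \<le> 2 * (2 * ?m + 1) * (4 ^ m / sqrt (2 * ?m + 1)) / (?m + 1)"
    using Suc by (intro divide_right_mono mult_left_mono) (auto simp: Z_def add.commute)
  also have "\<dots> = 2 * 4^m / (?m+1) * ((2 * ?m + 1) / sqrt (2*?m+1))" by (simp add: algebra_simps)
  also have "\<dots> \<le> 2 * 4^m / (?m+1) * ((2*?m+2) / sqrt (2*?m+3))"
    by (intro mult_left_mono key) auto
  also have "\<dots> = 2 * 4^m * ((2*?m+2) / (?m+1)) / sqrt (2*?m+3)" by simp
  also have "(2*?m+2) / (?m+1) = 2" by (simp add: field_simps)
  also have "2 * 4^m * 2 / sqrt (2*?m+3) = 4 ^ Suc m / sqrt (2 * Suc m + 1)" by simp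
  finally show ?case unfolding X_def .
qed simp

lemma binomial_le_two_power_div_sqrt: "real (j choose b) \<le> 2 ^ j / sqrt (j + 1)"
proof -
  have "real (j choose b) \<le> real (j choose (j div 2))"
    using binomial_maximum[of j b] by simp
  also have "\<dots> \<le> 2 ^ j / sqrt (j + 1)"
  proof (cases "even j")
    case True
    then obtain m where m: "j = 2 * m" by blast
    show ?thesis using central_binomial_le[of m] by (simp add: m power_mult)
  next
    case False
    then obtain m where m: "j = 2 * m + 1" using oddE by blast
    have "(2 * Suc m) choose Suc m = 2 * (Suc (2*m) choose m)"
      using binomial_symmetric[of m "Suc (2*m)"] by simp
    then have "real (j choose (j div 2)) = real ((2 * Suc m) choose Suc m) / 2"
      by (simp add: m)
    also have "\<dots> \<le> 4 ^ Suc m / sqrt (2 * Suc m + 1) / 2"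
      using central_binomial_le[of "Suc m"] by simp
    also have "\<dots> \<le> 4 ^ Suc m / sqrt (j + 1) / 2"
      by (simp add: m divide_simps)
    also have "\<dots> = 2 ^ j / sqrt (j + 1)" by (simp add: m power_mult)
    finally show ?thesis .
  qed
  finally show ?thesis .
qed

text \<open>
  One direction of the lattice: the binomial weights are replaced by their maximum. This is the
  source of the factor \<open>(j + 1)\<^sup>-\<^sup>1\<^sup>/\<^sup>2\<close> per dimension.
\<close>

lemma shift_sum_1_power_le:
  "(shift_sum 1 a ^^ j) f x \<le> ennreal (2 ^ j / sqrt (j + 1)) * shift_sum j a f x"
proof -
  have "(of_nat (j choose b) :: ennreal) \<le> ennreal (2 ^ j / sqrt (j + 1))" for b
    using binomial_le_two_power_div_sqrt[of j b] ennreal_leI ennreal_of_nat_eq_real_of_nat by presburger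
  then show ?thesis
    unfolding shift_sum_1_power shift_sum_def sum_distrib_left
    by (intro sum_mono mult_right_mono) auto
qed

lemma funpow_compose_commute:
  assumes "\<And>f. A (B f) = B (A f)"
  shows "((\<lambda>f. A (B f)) ^^ j) f = (A ^^ j) ((B ^^ j) f)"
proof (induction j)
  case (Suc j)
  have "B ((A ^^ j) g) = (A ^^ j) (B g)" for g
    by (induction j) (simp_all add: assms[symmetric])
  then show ?case by (simp add: Suc)
qed simp

lemma grid_sum_1_power_le:
  "(grid_sum 1 h l ^^ j) f x \<le> ennreal (2 ^ j / sqrt (j + 1)) ^ length l * grid_sum j h l f x"
proof (induction l arbitrary: x)
  case Nil
  have "((\<lambda>f. f) ^^ j) f = f" by (induction j) auto
  then show ?case by (simp del: One_nat_def)
next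
  case (Cons i l)
  let ?M = "ennreal (2 ^ j / sqrt (j + 1))"
  have "(grid_sum 1 h (i # l) ^^ j) f x = (shift_sum 1 (h *\<^sub>R i) ^^ j) ((grid_sum 1 h l ^^ j) f) x"
  proof -
    have "grid_sum 1 h (i # l) = (\<lambda>f. shift_sum 1 (h *\<^sub>R i) (grid_sum 1 h l f))" by auto
    then show ?thesis 
      by (simp add: funpow_compose_commute grid_sum_shift_sum_commute del: One_nat_def)
  qed
  also have "\<dots> \<le> ?M * shift_sum j (h *\<^sub>R i) ((grid_sum 1 h l ^^ j) f) x"
    by (rule shift_sum_1_power_le)
  also have "\<dots> \<le> ?M * shift_sum j (h *\<^sub>R i) (\<lambda>x. ?M ^ length l * grid_sum j h l f x) x"
    by (intro mult_left_mono shift_sum_mono Cons) auto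
  also have "\<dots> = ?M ^ length (i # l) * grid_sum j h (i # l) f x"
    by (simp add: shift_sum_cmult mult.assoc)
  finally show ?case .
qed

text \<open>
  The slabs \<open>b h \<le> x \<bullet> i < (b + 1) h\<close> are disjoint for distinct \<open>b\<close>. The predicate \<open>P\<close> stands for the
  conditions on the other coordinates, which shifts along \<open>i\<close> do not affect.
\<close>

lemma shift_sum_indicator_le:
  fixes i :: "'a::real_inner"
  assumes "0 < h" "i \<bullet> i = 1"
    and P: "\<And>x c. P (x - c *\<^sub>R i) \<longleftrightarrow> P x"
  shows "shift_sum m (h *\<^sub>R i) (indicator {x. (0 \<le> x \<bullet> i \<and> x \<bullet> i < h) \<and> P x}) x
    \<le> indicator {x. (0 \<le> x \<bullet> i \<and> x \<bullet> i < (real m + 1) * h) \<and> P x} x"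
proof -
  let ?S = "{x. (0 \<le> x \<bullet> i \<and> x \<bullet> i < h) \<and> P x}"
  define B where "B = {b \<in> {..m}. x - real b *\<^sub>R h *\<^sub>R i \<in> ?S}"
  have B: "b \<in> B \<Longrightarrow> b \<le> m \<and> real b * h \<le> x \<bullet> i \<and> x \<bullet> i < (real b + 1) * h \<and> P x" for b
    using P[of x "real b * h"] assms(2) by (auto simp: B_def inner_diff_left algebra_simps)
  have eq: "shift_sum m (h *\<^sub>R i) (indicator ?S) x = of_nat (card B)"
  proof -
    have "shift_sum m (h *\<^sub>R i) (indicator ?S) x = (\<Sum>b\<le>m. if x - real b *\<^sub>R h *\<^sub>R i \<in> ?S then 1 else 0)"
      unfolding shift_sum_def by (intro sum.cong) (auto simp: indicator_def)
    also have "\<dots> = of_nat (card B)"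
      unfolding B_def by (subst sum.inter_filter[symmetric]) auto
    finally show ?thesis .
  qed
  have "b = c" if "b \<in> B" "c \<in> B" for b c
  proof -
    have "real b * h < (real c + 1) * h" "real c * h < (real b + 1) * h"
      using B[OF that(1)] B[OF that(2)] by linarith+
    then show ?thesis using assms(1) by (simp add: mult_less_cancel_right)
  qed
  moreover have "finite B" by (simp add: B_def)
  ultimately have card: "card B \<le> 1" by (metis card_le_Suc0_iff_eq One_nat_def)
  show ?thesis
  proof (cases "B = {}")
    case False
    then obtain b where b: "b \<in> B" by blast
    have "0 \<le> real b * h" using assms by simp
    moreover have "(real b + 1) * h \<le> (real m + 1) * h" using B[OF b] assms by (intro mult_right_mono) auto
    ultimately have "0 \<le> x \<bullet> i \<and> x \<bullet> i < (real m + 1) * h \<and> P x" using B[OF b] by linarith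
    then show ?thesis using card unfolding eq
      by (simp add: indicator_def)
  next
    case True
    then show ?thesis unfolding eq by simp
  qed
qed

text \<open>
  The cube is half-open in order that its translates by multiples of \<open>h\<close> be disjoint.
\<close>

definition corner_box :: "real \<Rightarrow> 'a::euclidean_space set" where
  "corner_box h = {x. \<forall>i\<in>Basis. 0 \<le> x \<bullet> i \<and> x \<bullet> i < h}"

lemma corner_box_borel [measurable]: "corner_box h \<in> sets (borel :: 'a::euclidean_space measure)"
  unfolding corner_box_def by measurable

lemma emeasure_corner_box:
  assumes "0 \<le> h"
  shows "emeasure lborel (corner_box h :: 'a::euclidean_space set) = ennreal (h ^ DIM('a))"
proof (rule antisym)
  have in1: "(\<Sum>b\<in>Basis. h *\<^sub>R b) \<bullet> i = h" if "i \<in> Basis" for i :: 'a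
    using that by (simp add: inner_sum_left inner_Basis if_distrib sum.delta cong: if_cong)
  have "emeasure lborel (corner_box h :: 'a set) \<le> emeasure lborel (cbox 0 (\<Sum>b\<in>Basis. h *\<^sub>R b :: 'a))"
    by (rule emeasure_mono) (auto simp: corner_box_def mem_box in1 less_imp_le)
  also have "\<dots> = ennreal (h ^ DIM('a))" using assms by (subst emeasure_lborel_cbox) (auto simp: in1)
  finally show "emeasure lborel (corner_box h :: 'a set) \<le> ennreal (h ^ DIM('a))" .
  have "ennreal (h ^ DIM('a)) = emeasure lborel (box 0 (\<Sum>b\<in>Basis. h *\<^sub>R b :: 'a))"
    using assms by (subst emeasure_lborel_box) (auto simp: in1)
  also have "\<dots> \<le> emeasure lborel (corner_box h :: 'a set)"
    by (rule emeasure_mono) (auto simp: corner_box_def mem_box in1 less_imp_le)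
  finally show "ennreal (h ^ DIM('a)) \<le> emeasure lborel (corner_box h :: 'a set)" .
qed

text \<open>
  For \<open>m = 1\<close> this puts the bump below the indicator of a cube of side \<open>2h\<close>; for general \<open>m\<close> it
  says that lattice translates of a cube of side \<open>h\<close> do not pile up.
\<close>

lemma grid_sum_corner_box_le:
  fixes l :: "'a::euclidean_space list"
  assumes "0 < h" "distinct l" "set l \<subseteq> Basis"
  shows "grid_sum m h l (indicator (corner_box h)) x
    \<le> indicator {x. \<forall>i\<in>Basis. 0 \<le> x \<bullet> i \<and> x \<bullet> i < (if i \<in> set l then (real m + 1) * h else h)} x"
  using assms(2,3)
proof (induction l arbitrary: x)
  case Nil
  then show ?case by (simp add: corner_box_def)
next
  case (Cons i l)
  let ?w = "\<lambda>l k. if k \<in> set l then (real m + 1) * h else h"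
  let ?P = "\<lambda>x. \<forall>k\<in>Basis - {i}. 0 \<le> x \<bullet> k \<and> x \<bullet> k < ?w l k"
  have i: "i \<in> Basis" "i \<notin> set l" using Cons.prems by auto
  have P: "?P (x - c *\<^sub>R i) \<longleftrightarrow> ?P x" for x c
    using i by (auto simp: inner_diff_left inner_Basis)
  have 1: "{x. \<forall>k\<in>Basis. 0 \<le> x \<bullet> k \<and> x \<bullet> k < ?w l k} = {x. (0 \<le> x \<bullet> i \<and> x \<bullet> i < h) \<and> ?P x}"
    using i by auto
  have 2: "{x. (0 \<le> x \<bullet> i \<and> x \<bullet> i < (real m + 1) * h) \<and> ?P x} =
      {x. \<forall>k\<in>Basis. 0 \<le> x \<bullet> k \<and> x \<bullet> k < ?w (i # l) k}"
    using i by auto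
  have "grid_sum m h (i # l) (indicator (corner_box h)) x
     \<le> shift_sum m (h *\<^sub>R i) (indicator {x. (0 \<le> x \<bullet> i \<and> x \<bullet> i < h) \<and> ?P x}) x"
    unfolding grid_sum_Cons 1[symmetric] using Cons by (intro shift_sum_mono) auto
  also have "\<dots> \<le> indicator {x. (0 \<le> x \<bullet> i \<and> x \<bullet> i < (real m + 1) * h) \<and> ?P x} x"
    by (rule shift_sum_indicator_le[where P="?P", OF assms(1) _ P]) (use i in simp)
  finally show ?case unfolding 2 .
qed

definition basis_list :: "'a::euclidean_space list" where
  "basis_list = (SOME l. set l = Basis \<and> distinct l)"

lemma basis_list: "set (basis_list :: 'a::euclidean_space list) = Basis" "distinct (basis_list :: 'a list)"
  using someI_ex[OF finite_distinct_list[OF finite_Basis[where 'a='a]]] by (auto simp: basis_list_def)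

lemma length_basis_list [simp]: "length (basis_list :: 'a::euclidean_space list) = DIM('a)"
  using basis_list distinct_card by metis

text \<open>
  This is \<open>c\<close> times the indicator of the cube of side \<open>2h\<close> with lower corner \<open>p\<close>, written as a
  sum of \<open>2\<^sup>n\<close> cubes of side \<open>h\<close> so that its convolution powers are binomial.
\<close>

definition box_bump :: "real \<Rightarrow> real \<Rightarrow> 'a::euclidean_space \<Rightarrow> 'a \<Rightarrow> ennreal" where
  "box_bump c h p x = ennreal c * grid_sum 1 h basis_list (indicator (corner_box h)) (x - p)"

lemma box_bump_measurable [measurable]: "box_bump c h p \<in> borel_measurable borel"
  unfolding box_bump_def by measurable

lemma box_bump_le:
  assumes "0 < h"
  shows "box_bump c h p x \<le> ennreal c * indicator (corner_box (2 * h)) (x - p)"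
proof -
  have "grid_sum 1 h basis_list (indicator (corner_box h)) (x - p) \<le> indicator (corner_box (2 * h)) (x - p)"
    using grid_sum_corner_box_le[OF assms basis_list(2), of 1 "x - p"]
    by (simp add: basis_list corner_box_def cong: ball_cong)
  then show ?thesis unfolding box_bump_def by (rule mult_left_mono) simp
qed

lemma nn_integral_box_bump:
  assumes "0 < h" "0 \<le> c"
  shows "(\<integral>\<^sup>+x. box_bump c h (p::'a::euclidean_space) x \<partial>lborel) = ennreal (c * (2 * h) ^ DIM('a))"
  unfolding box_bump_def using assms
  by (simp add: nn_integral_cmult nn_integral_lborel_shift[where f="grid_sum _ _ _ _"] nn_integral_grid_sum emeasure_corner_box
     ennreal_mult power_mult_distrib ennreal_power[symmetric] del: One_nat_def)

text \<open>
  Lattice sums commute with convolutions and with translations, so the \<open>j\<close>th power can be taken of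
  each factor separately.
\<close>

lemma nnconv_box_bump_power:
  assumes [measurable]: "f \<in> borel_measurable borel"
  shows "(nnconv (box_bump c h p) ^^ j) f x =
    ennreal c ^ j * (grid_sum 1 h basis_list ^^ j) ((nnconv (indicator (corner_box h)) ^^ j) f) (x - real j *\<^sub>R p)"
proof (induction j arbitrary: x)
  case (Suc j)
  let ?q = "indicator (corner_box h) :: 'a \<Rightarrow> ennreal"
  let ?G = "grid_sum 1 h basis_list :: ('a \<Rightarrow> ennreal) \<Rightarrow> _"
  let ?g = "(?G ^^ j) ((nnconv ?q ^^ j) f)"
  have meas [measurable]: "(?G ^^ k) g \<in> borel_measurable borel" if "g \<in> borel_measurable borel" for k g
    using that by (induction k) auto
  have comm: "nnconv ?q ((?G ^^ k) g) = (?G ^^ k) (nnconv ?q g)" if [measurable]: "g \<in> borel_measurable borel" for k g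
    by (induction k) (simp_all add: nnconv_grid_sum del: One_nat_def)
  have step: "nnconv (box_bump c h p) g y = ennreal c * ?G (nnconv ?q g) (y - p)"
    if [measurable]: "g \<in> borel_measurable borel" for g y
    unfolding box_bump_def
    by (simp add: nnconv_cmult_kernel nnconv_shift_kernel[where K="?G ?q"] nnconv_grid_sum_kernel del: One_nat_def)
  have "(nnconv (box_bump c h p) ^^ Suc j) f x =
     nnconv (box_bump c h p) (\<lambda>x. ennreal c ^ j * ?g (x - real j *\<^sub>R p)) x"
    by (simp add: Suc[abs_def] del: One_nat_def)
  also have "\<dots> = ennreal c ^ j * nnconv (box_bump c h p) ?g (x - real j *\<^sub>R p)"
    by (simp add: nnconv_cmult nnconv_shift[where f="?g"] del: One_nat_def)
  also have "\<dots> = ennreal c ^ Suc j * ?G (nnconv ?q ?g) (x - real (Suc j) *\<^sub>R p)"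
    by (simp add: step algebra_simps del: One_nat_def)
  also have "nnconv ?q ?g = (?G ^^ j) ((nnconv ?q ^^ Suc j) f)"
    by (simp add: comm del: One_nat_def)
  finally show ?case by (simp del: One_nat_def)
qed simp

text \<open>
  Of the \<open>j\<close> convolutions with the indicator of the small cube, one is combined with the lattice sum
  into a kernel bounded by 1, which turns the integral of \<open>f\<close> into a pointwise bound. The other
  \<open>j - 1\<close> only multiply the integral by \<open>h\<^sup>n\<close>; hence the factor \<open>1 / h\<^sup>n\<close> that remains.
\<close>

lemma nnconv_box_bump_power_le:
  fixes f :: "'a::euclidean_space \<Rightarrow> ennreal"
  assumes [measurable]: "f \<in> borel_measurable borel" and "0 < h" "0 \<le> c" "0 < j"
  shows "(nnconv (box_bump c h p) ^^ j) f x
    \<le> ennreal ((c * (2 * h) ^ DIM('a)) ^ j * (1 / sqrt (j + 1)) ^ DIM('a) / h ^ DIM('a)) * (\<integral>\<^sup>+x. f x \<partial>lborel)"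
proof -
  let ?q = "indicator (corner_box h) :: 'a \<Rightarrow> ennreal"
  let ?n = "DIM('a)"
  let ?M = "2 ^ j / sqrt (j + 1)"
  obtain k where k: "j = Suc k" using assms(4) gr0_implies_Suc by blast
  define g where "g = (nnconv ?q ^^ k) f"
  have [measurable]: "g \<in> borel_measurable borel" by (simp add: g_def)
  have g_int: "(\<integral>\<^sup>+x. g x \<partial>lborel) = ennreal (h ^ ?n) ^ k * (\<integral>\<^sup>+x. f x \<partial>lborel)"
    using assms(2) by (simp add: g_def nn_integral_nnconv_power emeasure_corner_box)
  have 1: "grid_sum j h basis_list (nnconv ?q g) y \<le> (\<integral>\<^sup>+x. g x \<partial>lborel)" for y
  proof -
    have "grid_sum j h basis_list (nnconv ?q g) y = nnconv (grid_sum j h basis_list ?q) g y"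
      by (simp add: nnconv_grid_sum_kernel)
    also have "\<dots> \<le> (\<integral>\<^sup>+x. 1 * g x \<partial>lborel)"
      unfolding nnconv_def
    proof (intro nn_integral_mono mult_right_mono)
      fix z :: 'a
      show "grid_sum j h basis_list ?q (y - z) \<le> 1"
        by (rule order_trans[OF grid_sum_corner_box_le[OF assms(2) basis_list(2)]])
           (auto simp: basis_list indicator_def)
    qed simp
    finally show ?thesis by simp
  qed
  have "(nnconv (box_bump c h p) ^^ j) f x
     = ennreal c ^ j * (grid_sum 1 h basis_list ^^ j) (nnconv ?q g) (x - real j *\<^sub>R p)"
    by (simp add: nnconv_box_bump_power g_def k del: One_nat_def funpow.simps(2)) (simp del: One_nat_def)
  also have "\<dots> \<le> ennreal c ^ j * (ennreal ?M ^ ?n * grid_sum j h basis_list (nnconv ?q g) (x - real j *\<^sub>R p))"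
    using grid_sum_1_power_le[where l=basis_list] by (intro mult_left_mono) auto
  also have "\<dots> \<le> ennreal c ^ j * (ennreal ?M ^ ?n * (ennreal (h ^ ?n) ^ k * (\<integral>\<^sup>+x. f x \<partial>lborel)))"
    unfolding g_int[symmetric] by (intro mult_left_mono 1) auto
  also have "\<dots> = ennreal (c ^ j * ?M ^ ?n * (h ^ ?n) ^ k) * (\<integral>\<^sup>+x. f x \<partial>lborel)"
    using assms by (simp add: ennreal_mult ennreal_power mult.assoc)
  also have "c ^ j * ?M ^ ?n * (h ^ ?n) ^ k = (c * (2 * h) ^ ?n) ^ j * (1 / sqrt (j + 1)) ^ ?n / h ^ ?n"
    using assms(2) by (simp add: k power_mult_distrib power_divide field_simps flip: power_mult)
  finally show ?thesis .
qed

section \<open>Averages of the decay rate over binomial and Poisson laws\<close>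

text \<open>
  The rate \<open>(j + 1)\<^sup>-\<^sup>n\<^sup>/\<^sup>2\<close>; the summand 1 makes it meaningful, with value 1, for \<open>j = 0\<close>.
\<close>

definition sqrt_decay :: "nat \<Rightarrow> nat \<Rightarrow> real" where
  "sqrt_decay n j = (1 / sqrt (real j + 1)) ^ n"

lemma sqrt_decay_pos: "0 < sqrt_decay n j"
  by (simp add: sqrt_decay_def)

lemma sqrt_decay_square: "(sqrt_decay n j)\<^sup>2 = 1 / (real j + 1) ^ n"
proof -
  have "(sqrt_decay n j)\<^sup>2 = ((1 / sqrt (real j + 1))\<^sup>2) ^ n"
    unfolding sqrt_decay_def by (simp flip: power_mult add: mult.commute)
  then show ?thesis by (simp add: power_divide)
qed

lemma fact_add_le: "fact (j + n) \<le> fact n * (j + 1) ^ n * (fact j :: nat)"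
proof (induction n)
  case (Suc n)
  have "j + Suc n \<le> Suc n * (j + 1)" by simp
  then have "(j + Suc n) * fact (j + n) \<le> Suc n * (j + 1) * (fact n * (j + 1) ^ n * fact j)"
    by (intro mult_mono Suc.IH) auto
  then show ?case by (simp add: algebra_simps)
qed simp

lemma fact_add_ge: "fact N * (N + 1) ^ n \<le> (fact (N + n) :: nat)"
proof (induction n)
  case (Suc n)
  have "(N + 1) * (fact N * (N + 1) ^ n) \<le> (N + Suc n) * fact (N + n)"
    by (intro mult_mono Suc.IH) auto
  then show ?case by (simp add: algebra_simps)
qed simp

text \<open>
  The square of the rate is compared with \<open>j! / (j + n)!\<close> because this quotient merges with the
  factorials in binomial and Poisson weights into shifted weights of the same kind.
\<close>

lemma sqrt_decay_square_le: "(sqrt_decay n j)\<^sup>2 \<le> fact n * (fact j / fact (j + n))"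
proof -
  have "real (fact (j + n)) \<le> real (fact n * (j + 1) ^ n * fact j)"
    by (simp only: of_nat_le_iff fact_add_le)
  then have "fact (j + n) \<le> fact n * (real j + 1) ^ n * fact j"
    by (simp add: add.commute)
  then show ?thesis unfolding sqrt_decay_square by (simp add: divide_simps mult_ac)
qed

text \<open>
  The passage from the average of the square of the rate to the average of the rate itself, which
  treats odd and even \<open>n\<close> alike. The inequality between arithmetic and geometric mean,
  \<open>2 r a \<le> r\<^sup>2 + a\<^sup>2\<close>, plays the part of the Cauchy-Schwarz inequality.
\<close>

lemma weighted_sqrt_decay_le:
  fixes w :: "nat \<Rightarrow> real"
  assumes w: "\<And>j. j \<in> I \<Longrightarrow> 0 \<le> w j" "(\<Sum>j\<in>I. w j) \<le> 1" and "0 < a"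
    and avg: "(\<Sum>j\<in>I. w j * (fact j / fact (j + n))) \<le> A * a\<^sup>2"
  shows "(\<Sum>j\<in>I. w j * sqrt_decay n j) \<le> (fact n * A + 1) / 2 * a"
proof -
  have amgm: "sqrt_decay n j \<le> (fact n * (fact j / fact (j + n)) / a + a) / 2" for j
  proof -
    have "0 \<le> (sqrt_decay n j - a)\<^sup>2" by simp
    then have "2 * sqrt_decay n j * a \<le> (sqrt_decay n j)\<^sup>2 + a\<^sup>2"
      by (simp add: power2_diff)
    also have "\<dots> \<le> fact n * (fact j / fact (j + n)) + a\<^sup>2"
      by (intro add_right_mono sqrt_decay_square_le)
    finally have "sqrt_decay n j \<le> (fact n * (fact j / fact (j + n)) + a\<^sup>2) / (2 * a)"
      using \<open>0 < a\<close> by (simp add: pos_le_divide_eq mult_ac)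
    also have "\<dots> = (fact n * (fact j / fact (j + n)) / a + a) / 2"
      using \<open>0 < a\<close> by (simp add: add_divide_distrib power2_eq_square)
    finally show ?thesis .
  qed
  have "(\<Sum>j\<in>I. w j * sqrt_decay n j) \<le> (\<Sum>j\<in>I. w j * ((fact n * (fact j / fact (j + n)) / a + a) / 2))"
    by (intro sum_mono mult_left_mono amgm w)
  also have "\<dots> = fact n / (2 * a) * (\<Sum>j\<in>I. w j * (fact j / fact (j + n))) + a / 2 * (\<Sum>j\<in>I. w j)"
    unfolding sum_distrib_left sum.distrib[symmetric]
    by (intro sum.cong refl) (simp add: field_simps)
  also have "\<dots> \<le> fact n / (2 * a) * (A * a\<^sup>2) + a / 2 * 1"
    using \<open>0 < a\<close> by (intro add_mono mult_left_mono avg w) auto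
  also have "\<dots> = (fact n * A + 1) / 2 * a"
    using \<open>0 < a\<close> by (simp add: power2_eq_square field_simps)
  finally show ?thesis .
qed

text \<open>
  The shifted weights are those of a binomial law with \<open>N + n\<close> trials, up to the factor
  \<open>\<theta>\<^sup>-\<^sup>n N! / (N + n)!\<close>, so their sum is at most 1.
\<close>

lemma binomial_average_sqrt_decay_le:
  fixes \<theta> :: real
  assumes "0 < \<theta>" "\<theta> \<le> 1"
  shows "(\<Sum>j\<le>N. real (N choose j) * \<theta> ^ j * (1 - \<theta>) ^ (N - j) * sqrt_decay n j)
    \<le> (fact n * (1 / \<theta>) ^ n + 1) / 2 * sqrt_decay n N"
proof (rule weighted_sqrt_decay_le)
  show "0 < sqrt_decay n N" by (rule sqrt_decay_pos)
  show "0 \<le> real (N choose j) * \<theta> ^ j * (1 - \<theta>) ^ (N - j)" for j using assms by simp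
  have binom: "(\<Sum>j\<le>M. real (M choose j) * \<theta> ^ j * (1 - \<theta>) ^ (M - j)) = 1" for M
    using binomial_ring[of \<theta> "1 - \<theta>" M] by simp
  then show "(\<Sum>j\<le>N. real (N choose j) * \<theta> ^ j * (1 - \<theta>) ^ (N - j)) \<le> 1" by simp
  let ?b = "\<lambda>j. real (N + n choose j) * \<theta> ^ j * (1 - \<theta>) ^ (N + n - j)"
  have summand: "real (N choose j) * \<theta> ^ j * (1 - \<theta>) ^ (N - j) * (fact j / fact (j + n))
      = (1 / \<theta>) ^ n * (fact N / fact (N + n)) * ?b (j + n)" if "j \<le> N" for j
  proof -
    have e1: "real (N choose j) = fact N / (fact j * fact (N - j))"
      using that by (simp add: binomial_fact)
    have e2: "real (N + n choose (j + n)) = fact (N + n) / (fact (j + n) * fact (N - j))"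
      using that by (simp add: binomial_fact)
    have e3: "N + n - (j + n) = N - j" by simp
    show ?thesis
      unfolding e1 e2 e3 using assms by (simp add: field_simps power_add)
  qed
  have "(\<Sum>j\<le>N. real (N choose j) * \<theta> ^ j * (1 - \<theta>) ^ (N - j) * (fact j / fact (j + n)))
      = (1 / \<theta>) ^ n * (fact N / fact (N + n)) * (\<Sum>j\<le>N. ?b (j + n))"
    unfolding sum_distrib_left by (intro sum.cong refl summand) simp
  also have "\<dots> \<le> (1 / \<theta>) ^ n * (fact N / fact (N + n)) * 1"
  proof (rule mult_left_mono)
    have "(\<Sum>j\<le>N. ?b (j + n)) = sum ?b ((\<lambda>j. j + n) ` {..N})"
      by (subst sum.reindex) auto
    also have "\<dots> \<le> sum ?b {..N + n}"
      using assms by (intro sum_mono2) auto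
    finally show "(\<Sum>j\<le>N. ?b (j + n)) \<le> 1" using binom[of "N + n"] by simp
  qed (use assms in auto)
  also have "fact N / fact (N + n) \<le> (1 / (real N + 1) ^ n :: real)"
  proof -
    have "real (fact N * (N + 1) ^ n) \<le> real (fact (N + n))"
      by (simp only: of_nat_le_iff fact_add_ge)
    then have "fact N * (real N + 1) ^ n \<le> fact (N + n)" by (simp add: add.commute)
    then show ?thesis by (simp add: divide_simps)
  qed
  finally show "(\<Sum>j\<le>N. real (N choose j) * \<theta> ^ j * (1 - \<theta>) ^ (N - j) * (fact j / fact (j + n)))
      \<le> (1 / \<theta>) ^ n * (sqrt_decay n N)\<^sup>2"
    using assms by (simp add: sqrt_decay_square mult_left_mono)
qed

text \<open>
  The shifted weights are again Poisson weights, up to the factor \<open>t\<^sup>-\<^sup>n\<close>. Finite partial sums are enough,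
  as the bound does not depend on \<open>m\<close>.
\<close>

lemma poisson_average_sqrt_decay_le:
  assumes "0 < t"
  shows "(\<Sum>k<m. exp (- t) * (t ^ k / fact k) * sqrt_decay n k) \<le> (fact n + 1) / 2 * (1 / sqrt t) ^ n"
proof -
  have exp_ge: "(\<Sum>k<m. t ^ k / fact k) \<le> exp t" for m
  proof -
    have "(\<lambda>k. t ^ k / fact k) sums exp t"
      using exp_converges[of t] by (simp add: divide_inverse mult.commute)
    then show ?thesis using assms by (intro sum_le_suminf[of "\<lambda>k. t ^ k / fact k", THEN order_trans])
       (auto simp: sums_iff)
  qed
  have "(\<Sum>k<m. exp (- t) * (t ^ k / fact k) * sqrt_decay n k) \<le> (fact n * 1 + 1) / 2 * (1 / sqrt t) ^ n"
  proof (rule weighted_sqrt_decay_le)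
    show "0 < (1 / sqrt t) ^ n" using assms by simp
    show "0 \<le> exp (- t) * (t ^ k / fact k)" for k using assms by simp
    have "(\<Sum>k<m. exp (- t) * (t ^ k / fact k)) \<le> exp (- t) * exp t"
      unfolding sum_distrib_left[symmetric] by (intro mult_left_mono exp_ge) simp
    then show "(\<Sum>k<m. exp (- t) * (t ^ k / fact k)) \<le> 1" by (simp flip: exp_add)
    have "(\<Sum>k<m. exp (- t) * (t ^ k / fact k) * (fact k / fact (k + n)))
       = exp (- t) * (1 / t) ^ n * (\<Sum>k<m. t ^ (k + n) / fact (k + n))"
      unfolding sum_distrib_left using assms
      by (intro sum.cong refl) (simp add: power_add field_simps)
    also have "\<dots> \<le> exp (- t) * (1 / t) ^ n * exp t"
    proof (rule mult_left_mono)
      have "(\<Sum>k<m. t ^ (k + n) / fact (k + n)) = sum (\<lambda>k. t ^ k / fact k) ((\<lambda>k. k + n) ` {..<m})"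
        by (subst sum.reindex) auto
      also have "\<dots> \<le> (\<Sum>k<m + n. t ^ k / fact k)"
        using assms by (intro sum_mono2) auto
      finally show "(\<Sum>k<m. t ^ (k + n) / fact (k + n)) \<le> exp t" using exp_ge order_trans by blast
    qed (use assms in auto)
    also have "\<dots> = (1 / t) ^ n" by (simp add: exp_minus)
    also have "\<dots> = 1 * ((1 / sqrt t) ^ n)\<^sup>2"
    proof -
      have "((1 / sqrt t) ^ n)\<^sup>2 = ((1 / sqrt t)\<^sup>2) ^ n" by (simp flip: power_mult add: mult.commute)
      then show ?thesis using assms by (simp add: power_divide)
    qed
    finally show "(\<Sum>k<m. exp (- t) * (t ^ k / fact k) * (fact k / fact (k + n))) \<le> 1 * ((1 / sqrt t) ^ n)\<^sup>2" .
  qed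
  then show ?thesis by simp
qed

section \<open>Decay of convolution powers of a probability density\<close>

lemma nnconv_binomial:
  assumes [measurable]: "U \<in> borel_measurable borel" "V \<in> borel_measurable borel"
    "f \<in> borel_measurable borel"
  shows "(nnconv (\<lambda>x. U x + V x) ^^ N) f =
    (\<lambda>x. \<Sum>j\<le>N. of_nat (N choose j) * (nnconv U ^^ j) ((nnconv V ^^ (N - j)) f) x)"
proof (induction N)
  case (Suc N)
  define A where "A j m = (nnconv U ^^ j) ((nnconv V ^^ m) f)" for j m
  have [measurable]: "A j m \<in> borel_measurable borel" for j m unfolding A_def by measurable
  have U_A: "nnconv U (A j m) = A (Suc j) m" for j m by (simp add: A_def)
  have V_A: "nnconv V (A j m) = A j (Suc m)" for j m by (simp add: A_def nnconv_power_commute)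
  let ?S = "\<lambda>x. \<Sum>j\<le>N. of_nat (N choose j) * A j (N - j) x"
  have "(nnconv (\<lambda>x. U x + V x) ^^ Suc N) f = nnconv (\<lambda>x. U x + V x) ?S"
    using Suc by (simp add: A_def)
  also have "\<dots> = (\<lambda>x. nnconv U ?S x + nnconv V ?S x)"
    by (rule nnconv_add_kernel) measurable
  also have "nnconv U ?S = (\<lambda>x. \<Sum>j\<le>N. of_nat (N choose j) * A (Suc j) (N - j) x)"
    by (simp add: nnconv_sum nnconv_cmult U_A)
  also have "nnconv V ?S = (\<lambda>x. \<Sum>j\<le>N. of_nat (N choose j) * A j (Suc N - j) x)"
    by (simp add: nnconv_sum nnconv_cmult V_A Suc_diff_le)
  also have "(\<lambda>x. (\<Sum>j\<le>N. of_nat (N choose j) * A (Suc j) (N - j) x) +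
        (\<Sum>j\<le>N. of_nat (N choose j) * A j (Suc N - j) x)) =
      (\<lambda>x. \<Sum>j\<le>Suc N. of_nat (Suc N choose j) * A j (Suc N - j) x)"
    by (subst sum_binomial_Suc) (simp add: add.commute)
  finally show ?case by (simp only: A_def)
qed simp

text \<open>
  Expand the \<open>N\<close>th power of \<open>L = U + V\<close>, where \<open>U\<close> is the bump. A term with \<open>j > 0\<close> factors \<open>U\<close> decays like
  \<open>(j + 1)\<^sup>-\<^sup>n\<^sup>/\<^sup>2\<close> relative to its mass \<open>\<theta>\<^sup>j (1 - \<theta>)\<^sup>N\<^sup>-\<^sup>j\<close>. The term without any factor \<open>U\<close> need not be bounded in
  terms of the integral of \<open>f\<close>, so the supremum \<open>B\<close> of \<open>f\<close> enters; it has mass \<open>(1 - \<theta>)\<^sup>N\<close>.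
\<close>

lemma nnconv_power_decay_if_bump:
  fixes L :: "'a::euclidean_space \<Rightarrow> ennreal"
  assumes L [measurable]: "L \<in> borel_measurable borel" and L_int: "(\<integral>\<^sup>+x. L x \<partial>lborel) = 1"
    and hc: "0 < h" "0 < c"
    and le: "\<And>x. box_bump c h p x \<le> L x"
  shows "\<exists>C>0. \<forall>f B N x. f \<in> borel_measurable borel \<longrightarrow> (\<forall>x. f x \<le> B) \<longrightarrow>
    (nnconv L ^^ N) f x \<le> ennreal (C * sqrt_decay DIM('a) N) * ((\<integral>\<^sup>+x. f x \<partial>lborel) + B)"
proof -
  let ?n = "DIM('a)"
  let ?U = "box_bump c h p :: 'a \<Rightarrow> ennreal"
  define V where "V x = L x - ?U x" for x
  have V_meas [measurable]: "V \<in> borel_measurable borel" unfolding V_def by measurable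
  have "?U x \<le> ennreal c * 1" for x
    by (rule order_trans[OF box_bump_le[OF hc(1)]]) (intro mult_left_mono, auto simp: indicator_def)
  then have "?U x < top" for x by (rule le_less_trans) simp
  then have UV: "L = (\<lambda>x. ?U x + V x)"
    unfolding V_def using le by (simp add: fun_eq_iff add_diff_inverse_ennreal)
  define \<theta> where "\<theta> = c * (2 * h) ^ ?n"
  have U_int: "(\<integral>\<^sup>+x. ?U x \<partial>lborel) = ennreal \<theta>"
    unfolding \<theta>_def using hc by (intro nn_integral_box_bump) auto
  have \<theta>_pos: "0 < \<theta>" using hc by (simp add: \<theta>_def)
  have UV_int: "ennreal \<theta> + (\<integral>\<^sup>+x. V x \<partial>lborel) = 1"
    using L_int unfolding UV by (simp add: nn_integral_add U_int)
  then have "ennreal \<theta> \<le> ennreal 1" by (metis ennreal_1 le_iff_add)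
  then have \<theta>_le: "\<theta> \<le> 1" by simp
  have V_int: "(\<integral>\<^sup>+x. V x \<partial>lborel) = ennreal (1 - \<theta>)"
  proof -
    have "(\<integral>\<^sup>+x. V x \<partial>lborel) = 1 - ennreal \<theta>"
      using UV_int by (metis ennreal_add_diff_cancel_left ennreal_neq_top)
    then show ?thesis using \<theta>_pos by (simp add: ennreal_minus flip: ennreal_1)
  qed
  define A where "A = 1 + 1 / h ^ ?n"
  have A: "1 \<le> A" "1 / h ^ ?n \<le> A" using hc by (auto simp: A_def)
  define C where "C = A * ((fact ?n * (1 / \<theta>) ^ ?n + 1) / 2)"
  have "0 < C" unfolding C_def using A \<theta>_pos by (intro mult_pos_pos divide_pos_pos add_nonneg_pos) auto
  have main: "(nnconv L ^^ N) f x \<le> ennreal (C * sqrt_decay ?n N) * ((\<integral>\<^sup>+x. f x \<partial>lborel) + B)"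
    if f [measurable]: "f \<in> borel_measurable borel" and fB: "\<forall>x. f x \<le> B" for f B N x
  proof -
    let ?S = "(\<integral>\<^sup>+x. f x \<partial>lborel) + B"
    have each: "(nnconv ?U ^^ j) ((nnconv V ^^ m) f) x \<le> ennreal (A * (\<theta> ^ j * (1 - \<theta>) ^ m * sqrt_decay ?n j)) * ?S" for j m
    proof (cases "j = 0")
      case True
      have "(nnconv V ^^ m) f x \<le> ennreal (1 - \<theta>) ^ m * B"
        using nnconv_power_le_sup[OF V_meas, of f B m x] fB by (simp add: V_int)
      also have "\<dots> \<le> ennreal (A * (1 - \<theta>) ^ m) * ?S"
        unfolding ennreal_power[OF diff_ge_0_iff_ge[THEN iffD2, OF \<theta>_le]]
        using A(1) \<theta>_le by (intro mult_mono ennreal_leI) (auto intro: mult_right_mono[of 1 A, simplified])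
      finally show ?thesis using True by (simp add: sqrt_decay_def)
    next
      case False
      let ?g = "(nnconv V ^^ m) f"
      have "(nnconv ?U ^^ j) ?g x \<le> ennreal (\<theta> ^ j * sqrt_decay ?n j / h ^ ?n) * (\<integral>\<^sup>+x. ?g x \<partial>lborel)"
        using nnconv_box_bump_power_le[of ?g h c j p x] False hc
        by (simp add: \<theta>_def sqrt_decay_def add.commute)
      also have "(\<integral>\<^sup>+x. ?g x \<partial>lborel) = ennreal ((1 - \<theta>) ^ m) * (\<integral>\<^sup>+x. f x \<partial>lborel)"
        using \<theta>_le by (simp add: nn_integral_nnconv_power V_int ennreal_power)
      also have "ennreal (\<theta> ^ j * sqrt_decay ?n j / h ^ ?n) * (ennreal ((1 - \<theta>) ^ m) * (\<integral>\<^sup>+x. f x \<partial>lborel))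
         = ennreal ((1 / h ^ ?n) * (\<theta> ^ j * (1 - \<theta>) ^ m * sqrt_decay ?n j)) * (\<integral>\<^sup>+x. f x \<partial>lborel)"
      proof -
        have "(1 / h ^ ?n) * (\<theta> ^ j * (1 - \<theta>) ^ m * sqrt_decay ?n j) = (\<theta> ^ j * sqrt_decay ?n j / h ^ ?n) * (1 - \<theta>) ^ m"
          by simp
        moreover have "0 \<le> \<theta> ^ j * sqrt_decay ?n j / h ^ ?n" "0 \<le> (1 - \<theta>) ^ m"
          using \<theta>_pos \<theta>_le hc sqrt_decay_pos[of ?n j] by auto
        ultimately show ?thesis by (simp only: ennreal_mult mult.assoc)
      qed
      also have "\<dots> \<le> ennreal (A * (\<theta> ^ j * (1 - \<theta>) ^ m * sqrt_decay ?n j)) * ?S"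
        using A(2) \<theta>_pos \<theta>_le sqrt_decay_pos[of ?n j]
        by (intro mult_mono ennreal_leI mult_right_mono) auto
      finally show ?thesis .
    qed
    have "(nnconv L ^^ N) f x = (\<Sum>j\<le>N. of_nat (N choose j) * (nnconv ?U ^^ j) ((nnconv V ^^ (N - j)) f) x)"
      unfolding UV by (subst nnconv_binomial) auto
    also have "\<dots> \<le> (\<Sum>j\<le>N. of_nat (N choose j) *
        (ennreal (A * (\<theta> ^ j * (1 - \<theta>) ^ (N - j) * sqrt_decay ?n j)) * ?S))"
      by (intro sum_mono mult_left_mono each) auto
    also have "\<dots> = (\<Sum>j\<le>N. ennreal (A * (real (N choose j) * \<theta> ^ j * (1 - \<theta>) ^ (N - j) * sqrt_decay ?n j))) * ?S"
      unfolding sum_distrib_right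
    proof (intro sum.cong refl)
      fix j
      let ?r = "A * (\<theta> ^ j * (1 - \<theta>) ^ (N - j) * sqrt_decay ?n j)"
      have "A * (real (N choose j) * \<theta> ^ j * (1 - \<theta>) ^ (N - j) * sqrt_decay ?n j) = real (N choose j) * ?r"
        by (simp add: mult_ac)
      moreover have "0 \<le> ?r" using A \<theta>_pos \<theta>_le sqrt_decay_pos[of ?n j] by simp
      ultimately show "of_nat (N choose j) * (ennreal ?r * ?S) =
          ennreal (A * (real (N choose j) * \<theta> ^ j * (1 - \<theta>) ^ (N - j) * sqrt_decay ?n j)) * ?S"
        by (simp only: ennreal_mult[OF of_nat_0_le_iff] ennreal_of_nat_eq_real_of_nat mult.assoc)
    qed
    also have "\<dots> = ennreal (A * (\<Sum>j\<le>N. real (N choose j) * \<theta> ^ j * (1 - \<theta>) ^ (N - j) * sqrt_decay ?n j)) * ?S"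
    proof -
      have "0 \<le> A * (real (N choose j) * \<theta> ^ j * (1 - \<theta>) ^ (N - j) * sqrt_decay ?n j)" for j
        using A \<theta>_pos \<theta>_le sqrt_decay_pos[of ?n j] by simp
      then show ?thesis unfolding sum_distrib_left by (simp only: sum_ennreal)
    qed
    also have "\<dots> \<le> ennreal (C * sqrt_decay ?n N) * ?S"
      unfolding C_def mult.assoc[of A]
      using A binomial_average_sqrt_decay_le[OF \<theta>_pos \<theta>_le, of N ?n]
      by (intro mult_right_mono ennreal_leI mult_left_mono) auto
    finally show ?thesis .
  qed
  with \<open>0 < C\<close> show ?thesis by blast
qed

text \<open>
  The square \<open>K * K\<close> dominates a bump, so even powers decay. An odd power is an even one applied to
  the convolution of \<open>K\<close> and \<open>f\<close>, which has the same integral and the same bound as \<open>f\<close>.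
\<close>

lemma nnconv_power_decay:
  fixes K :: "'a::euclidean_space \<Rightarrow> ennreal"
  assumes K [measurable]: "K \<in> borel_measurable borel" and K_int: "(\<integral>\<^sup>+x. K x \<partial>lborel) = 1"
  shows "\<exists>C>0. \<forall>f B k x. f \<in> borel_measurable borel \<longrightarrow> (\<forall>x. f x \<le> B) \<longrightarrow>
    (nnconv K ^^ k) f x \<le> ennreal (C * sqrt_decay DIM('a) k) * ((\<integral>\<^sup>+x. f x \<partial>lborel) + B)"
proof -
  let ?n = "DIM('a)"
  let ?L = "nnconv K K"
  obtain p r c where p: "0 < r" "0 < c" "\<forall>x\<in>ball p r. ennreal c \<le> ?L x"
    using K by (rule nnconv_self_positive_on_ball) (simp add: K_int)
  \<comment> \<open>a cube of side \<open>2h\<close> then has all points at distance at most \<open>r / 2\<close> from its lower corner\<close>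
  define h where "h = r / (4 * ?n)"
  have h: "0 < h" using p by (simp add: h_def)
  have bump: "box_bump c h p x \<le> ?L x" for x
  proof (cases "x - p \<in> corner_box (2 * h)")
    case True
    have "norm (x - p) \<le> (\<Sum>i\<in>Basis. \<bar>(x - p) \<bullet> i\<bar>)" by (rule norm_le_l1)
    also have "\<dots> \<le> (\<Sum>i\<in>(Basis::'a set). 2 * h)"
      using True by (intro sum_mono) (auto simp: corner_box_def)
    also have "\<dots> = r / 2" by (simp add: h_def)
    finally have "x \<in> ball p r" using p by (simp add: dist_norm norm_minus_commute)
    then have "ennreal c \<le> ?L x" using p by blast
    then show ?thesis using box_bump_le[OF h, of c p x] True by simp
  next
    case False
    then show ?thesis using box_bump_le[OF h, of c p x] by simp
  qed
  have L_int: "(\<integral>\<^sup>+x. ?L x \<partial>lborel) = 1" by (simp add: nn_integral_nnconv K_int)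
  obtain C where C: "0 < C" "\<And>f B N x. f \<in> borel_measurable borel \<Longrightarrow> \<forall>x. f x \<le> B \<Longrightarrow>
      (nnconv ?L ^^ N) f x \<le> ennreal (C * sqrt_decay ?n N) * ((\<integral>\<^sup>+x. f x \<partial>lborel) + B)"
    using nnconv_power_decay_if_bump[OF nnconv_measurable[OF K K] L_int h p(2) bump] by blast
  have double: "(nnconv ?L ^^ N) f = (nnconv K ^^ (2 * N)) f"
    if [measurable]: "f \<in> borel_measurable borel" for f N
    by (induction N) (simp_all flip: nnconv_assoc)
  have half: "sqrt_decay ?n (k div 2) \<le> sqrt 2 ^ ?n * sqrt_decay ?n k" for k
  proof -
    have "k + 1 \<le> 2 * (k div 2 + 1)" by presburger
    then have "real (k + 1) \<le> real (2 * (k div 2 + 1))" by (simp only: of_nat_le_iff)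
    then have "real k + 1 \<le> 2 * (real (k div 2) + 1)" by simp
    then have "sqrt (real k + 1) \<le> sqrt 2 * sqrt (real (k div 2) + 1)"
      by (metis real_sqrt_le_iff real_sqrt_mult)
    then have "1 / sqrt (real (k div 2) + 1) \<le> sqrt 2 * (1 / sqrt (real k + 1))"
      by (simp add: divide_simps mult_ac)
    then have "(1 / sqrt (real (k div 2) + 1)) ^ ?n \<le> (sqrt 2 * (1 / sqrt (real k + 1))) ^ ?n"
      by (intro power_mono) auto
    then show ?thesis by (simp only: sqrt_decay_def power_mult_distrib)
  qed
  have "(nnconv K ^^ k) f x \<le> ennreal (C * sqrt 2 ^ ?n * sqrt_decay ?n k) * ((\<integral>\<^sup>+x. f x \<partial>lborel) + B)"
    if [measurable]: "f \<in> borel_measurable borel" and B: "\<forall>x. f x \<le> B" for f B k x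
  proof -
    let ?g = "(nnconv K ^^ (k mod 2)) f"
    have g_le: "\<forall>x. ?g x \<le> B"
      using nnconv_power_le_sup[OF K, of f B "k mod 2"] B by (simp add: K_int)
    have g_int: "(\<integral>\<^sup>+x. ?g x \<partial>lborel) = (\<integral>\<^sup>+x. f x \<partial>lborel)"
      by (simp add: nn_integral_nnconv_power K_int)
    have "(nnconv K ^^ k) f = (nnconv K ^^ (2 * (k div 2))) ?g"
      by (metis comp_apply funpow_add mult_div_mod_eq)
    then have "(nnconv K ^^ k) f x = (nnconv ?L ^^ (k div 2)) ?g x" by (simp add: double)
    also have "\<dots> \<le> ennreal (C * sqrt_decay ?n (k div 2)) * ((\<integral>\<^sup>+x. f x \<partial>lborel) + B)"
      using C(2)[OF _ g_le, of "k div 2" x] by (simp add: g_int)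
    also have "\<dots> \<le> ennreal (C * sqrt 2 ^ ?n * sqrt_decay ?n k) * ((\<integral>\<^sup>+x. f x \<partial>lborel) + B)"
      unfolding mult.assoc using C(1) half[of k]
      by (intro mult_right_mono ennreal_leI mult_left_mono) auto
    finally show ?thesis .
  qed
  moreover have "0 < C * sqrt 2 ^ ?n" using C by simp
  ultimately show ?thesis by blast
qed

section \<open>Almost everywhere equal data\<close>

lemma borel_representative_complex:
  fixes f :: "'a::euclidean_space \<Rightarrow> complex"
  assumes "f \<in> borel_measurable lebesgue"
  obtains g where "g \<in> borel_measurable borel" "AE x in lborel. f x = g x"
proof -
  have "(\<lambda>x. Re (f x)) \<in> borel_measurable lebesgue" "(\<lambda>x. Im (f x)) \<in> borel_measurable lebesgue"
    using assms by (simp_all add: borel_measurable_complex_iff)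
  from this[THEN completion_ex_borel_measurable_real]
  obtain a b where [measurable]: "a \<in> borel_measurable lborel" "b \<in> borel_measurable lborel"
    and ae: "AE x in lborel. Re (f x) = a x" "AE x in lborel. Im (f x) = b x" by blast
  show thesis
  proof
    have "(\<lambda>x. Complex (a x) (b x)) \<in> borel_measurable lborel"
      unfolding borel_measurable_complex_iff by simp
    then show "(\<lambda>x. Complex (a x) (b x)) \<in> borel_measurable borel" by simp
    show "AE x in lborel. f x = Complex (a x) (b x)"
      using ae by eventually_elim (simp add: complex_eq_iff)
  qed
qed

lemma AE_lborel_reflect:
  fixes P :: "'a::euclidean_space \<Rightarrow> bool"
  assumes "AE z in lborel. P z"
  shows "AE y in lborel. P (a - y)"
proof -
  obtain N where N: "{z. \<not> P z} \<subseteq> N" "emeasure lborel N = 0" and [measurable]: "N \<in> sets borel"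
    using assms by (auto elim: AE_E)
  have "emeasure lborel {y. a - y \<in> N} = (\<integral>\<^sup>+y. indicator {y. a - y \<in> N} y \<partial>lborel)"
    by (rule nn_integral_indicator[symmetric]) measurable
  also have "\<dots> = (\<integral>\<^sup>+y. indicator N (a - y) \<partial>lborel)"
    by (simp add: indicator_def)
  also have "\<dots> = 0" using N by (simp add: nn_integral_lborel_reflect)
  finally have "emeasure lborel {y. a - y \<in> N} = 0" .
  then show ?thesis
    by (intro AE_I[where N="{y. a - y \<in> N}"]) (use N in auto)
qed

text \<open>
  Equality holds at every point, not only almost everywhere: convolution sees its arguments only
  through integrals. Hence all iterates from the first on may be computed with Borel functions.
\<close>

lemma conv_op_cong_AE:
  fixes J J' u u' :: "'a::euclidean_space \<Rightarrow> complex"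
  assumes [measurable]: "J' \<in> borel_measurable borel" "u' \<in> borel_measurable borel"
    and ae: "AE x in lborel. J x = J' x" "AE x in lborel. u x = u' x"
  shows "conv_op J u = conv_op J' u'"
proof
  fix x
  have "AE y in lborel. J (x - y) = J' (x - y)" by (rule AE_lborel_reflect[OF ae(1)])
  with ae(2) have "AE y in lborel. J' (x - y) * u' y = J (x - y) * u y"
    by eventually_elim simp
  then have eq: "AE y in lebesgue. J' (x - y) * u' y = J (x - y) * u y" by (rule AE_completion)
  have m: "(\<lambda>y. J' (x - y) * u' y) \<in> borel_measurable lebesgue"
    by (rule measurable_completion) measurable
  have "(LINT y|lebesgue. J (x - y) * u y) = (LINT y|lebesgue. J' (x - y) * u' y)"
    by (rule integral_cong_AE[OF borel_measurable_AE[OF m eq] m]) (use eq in eventually_elim, simp)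
  then show "conv_op J u x = conv_op J' u' x" by (simp add: conv_op_def)
qed

lemma conv_op_borel:
  fixes J u :: "'a::euclidean_space \<Rightarrow> complex"
  assumes [measurable]: "J \<in> borel_measurable borel" "u \<in> borel_measurable borel"
  shows "conv_op J u = (\<lambda>x. LINT y|lborel. J (x - y) * u y)"
  unfolding conv_op_def by (intro ext integral_completion) measurable

lemma conv_op_measurable [measurable]:
  fixes J u :: "'a::euclidean_space \<Rightarrow> complex"
  assumes [measurable]: "J \<in> borel_measurable borel" "u \<in> borel_measurable borel"
  shows "conv_op J u \<in> borel_measurable borel"
  by (simp add: conv_op_borel)

lemma conv_op_power_measurable [measurable]:
  fixes J u :: "'a::euclidean_space \<Rightarrow> complex"
  assumes [measurable]: "J \<in> borel_measurable borel" "u \<in> borel_measurable borel"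
  shows "(conv_op J ^^ k) u \<in> borel_measurable borel"
  by (induction k) auto

lemma conv_op_power_cong_AE:
  fixes J J' u u' :: "'a::euclidean_space \<Rightarrow> complex"
  assumes J' [measurable]: "J' \<in> borel_measurable borel" and u' [measurable]: "u' \<in> borel_measurable borel"
    and ae: "AE x in lborel. J x = J' x" "AE x in lborel. u x = u' x"
  shows "(conv_op J ^^ Suc k) u = (conv_op J' ^^ Suc k) u'"
proof (induction k)
  case 0
  show ?case using conv_op_cong_AE[OF J' u' ae] by simp
next
  case (Suc k)
  have "(conv_op J ^^ Suc (Suc k)) u = conv_op J ((conv_op J' ^^ Suc k) u')"
    using Suc by simp
  also have "\<dots> = conv_op J' ((conv_op J' ^^ Suc k) u')"
    by (rule conv_op_cong_AE[OF J' _ ae(1)]) measurable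
  finally show ?case by simp
qed

text \<open>
  Only the term of order 0 of the series, the initial value itself, can differ on a null set.
\<close>

lemma nonlocal_solution_cong_AE:
  fixes J J' u u' :: "'a::euclidean_space \<Rightarrow> complex"
  assumes "J' \<in> borel_measurable borel" "u' \<in> borel_measurable borel"
    and ae: "AE x in lborel. J x = J' x" "AE x in lborel. u x = u' x"
  shows "AE x in lborel. nonlocal_solution c J u t x = nonlocal_solution c J' u' t x"
  using ae(2)
proof eventually_elim
  fix x assume "u x = u' x"
  then have "(conv_op J ^^ k) u x = (conv_op J' ^^ k) u' x" for k
    using conv_op_power_cong_AE[OF assms] by (cases k) (simp_all del: funpow.simps(2))
  then show "nonlocal_solution c J u t x = nonlocal_solution c J' u' t x"
    by (simp add: nonlocal_solution_def)
qed

section \<open>Bounds on the solution\<close>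

lemma norm_conv_op_le:
  fixes J u :: "'a::euclidean_space \<Rightarrow> complex"
  assumes [measurable]: "J \<in> borel_measurable borel" "u \<in> borel_measurable borel"
  shows "ennreal (norm (conv_op J u x)) \<le> nnconv (\<lambda>x. ennreal (norm (J x))) (\<lambda>x. ennreal (norm (u x))) x"
proof (cases "integrable lborel (\<lambda>y. J (x - y) * u y)")
  case True
  then show ?thesis
    using integral_norm_bound_ennreal[OF True]
    by (simp add: conv_op_borel nnconv_def norm_mult ennreal_mult)
next
  case False
  then show ?thesis by (simp add: conv_op_borel not_integrable_integral_eq)
qed

lemma norm_conv_op_power_le:
  fixes J u :: "'a::euclidean_space \<Rightarrow> complex"
  assumes [measurable]: "J \<in> borel_measurable borel" "u \<in> borel_measurable borel"
  shows "ennreal (norm ((conv_op J ^^ k) u x))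
    \<le> (nnconv (\<lambda>x. ennreal (norm (J x))) ^^ k) (\<lambda>x. ennreal (norm (u x))) x"
proof (induction k arbitrary: x)
  case (Suc k)
  have "ennreal (norm ((conv_op J ^^ Suc k) u x))
     \<le> nnconv (\<lambda>x. ennreal (norm (J x))) (\<lambda>x. ennreal (norm ((conv_op J ^^ k) u x))) x"
    using norm_conv_op_le[of J "(conv_op J ^^ k) u" x] by simp
  also have "\<dots> \<le> nnconv (\<lambda>x. ennreal (norm (J x)))
      ((nnconv (\<lambda>x. ennreal (norm (J x))) ^^ k) (\<lambda>x. ennreal (norm (u x)))) x"
    by (rule nnconv_mono[OF Suc])
  finally show ?case by simp
qed simp

lemma nonlocal_solution_measurable:
  fixes J u :: "'a::euclidean_space \<Rightarrow> complex"
  assumes [measurable]: "J \<in> borel_measurable borel" "u \<in> borel_measurable borel"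
  shows "nonlocal_solution c J u t \<in> borel_measurable borel"
  unfolding nonlocal_solution_def by measurable

lemma norm_nonlocal_solution_le:
  fixes J u :: "'a::euclidean_space \<Rightarrow> complex"
  defines "K \<equiv> \<lambda>x. ennreal (norm (J x))" and "f \<equiv> \<lambda>x. ennreal (norm (u x))"
  assumes J [measurable]: "J \<in> borel_measurable borel" and u [measurable]: "u \<in> borel_measurable borel"
    and J_int: "(\<integral>\<^sup>+x. norm (J x) \<partial>lborel) = 1" and B: "\<And>x. norm (u x) \<le> B" and "0 \<le> t"
  shows "ennreal (norm (nonlocal_solution 1 J u t x))
    \<le> (\<Sum>k. ennreal (exp (- t) * (t ^ k / fact k)) * (nnconv K ^^ k) f x)"
proof -
  let ?a = "\<lambda>k. complex_of_real (t ^ k / fact k) * (conv_op J ^^ k) u x"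
  have K_meas [measurable]: "K \<in> borel_measurable borel" unfolding K_def by measurable
  have "0 \<le> B" using B[of undefined] norm_ge_zero order_trans by blast
  have it_le: "ennreal (norm ((conv_op J ^^ k) u x)) \<le> (nnconv K ^^ k) f x" for k
    using norm_conv_op_power_le[OF J u, of k x] by (simp add: K_def f_def)
  have "(nnconv K ^^ k) f x \<le> ennreal B" for k
    using nnconv_power_le_sup[OF K_meas, of f "ennreal B" k x] B J_int
    by (simp add: K_def f_def ennreal_leI)
  then have "ennreal (norm ((conv_op J ^^ k) u x)) \<le> ennreal B" for k
    using it_le order_trans by blast
  then have it_B: "norm ((conv_op J ^^ k) u x) \<le> B" for k using \<open>0 \<le> B\<close> by simp
  have a_norm: "norm (?a k) = t ^ k / fact k * norm ((conv_op J ^^ k) u x)" for k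
    using \<open>0 \<le> t\<close> by (simp add: norm_mult norm_divide norm_power)
  have "summable (\<lambda>k. t ^ k / fact k * B)"
    using summable_exp_generic[of t] by (intro summable_mult2) (simp add: divide_inverse mult.commute)
  then have summ: "summable (\<lambda>k. norm (?a k))"
  proof (rule summable_comparison_test')
    show "norm (norm (?a k)) \<le> t ^ k / fact k * B" if "0 \<le> k" for k
    proof -
      have "norm (?a k) \<le> t ^ k / fact k * B"
        unfolding a_norm using \<open>0 \<le> t\<close> it_B by (intro mult_left_mono) auto
      then show ?thesis by simp
    qed
  qed
  have "norm (nonlocal_solution 1 J u t x) = exp (- t) * norm (\<Sum>k. ?a k)"
    by (simp add: nonlocal_solution_def norm_mult)
  also have "\<dots> \<le> exp (- t) * (\<Sum>k. norm (?a k))"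
    by (intro mult_left_mono summable_norm summ) simp
  also have "\<dots> = (\<Sum>k. exp (- t) * norm (?a k))"
    by (rule suminf_mult[symmetric, OF summ])
  finally have "ennreal (norm (nonlocal_solution 1 J u t x)) \<le> ennreal (\<Sum>k. exp (- t) * norm (?a k))"
    by (rule ennreal_leI)
  also have "\<dots> = (\<Sum>k. ennreal (exp (- t) * norm (?a k)))"
    by (intro suminf_ennreal2[symmetric] summable_mult summ) simp
  also have "\<dots> \<le> (\<Sum>k. ennreal (exp (- t) * (t ^ k / fact k)) * (nnconv K ^^ k) f x)"
  proof (intro suminf_le allI)
    fix k
    have "ennreal (exp (- t) * norm (?a k))
       = ennreal (exp (- t) * (t ^ k / fact k)) * ennreal (norm ((conv_op J ^^ k) u x))"
      unfolding a_norm mult.assoc[symmetric] using \<open>0 \<le> t\<close> by (intro ennreal_mult) auto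
    also have "\<dots> \<le> ennreal (exp (- t) * (t ^ k / fact k)) * (nnconv K ^^ k) f x"
      by (intro mult_left_mono it_le) simp
    finally show "ennreal (exp (- t) * norm (?a k))
       \<le> ennreal (exp (- t) * (t ^ k / fact k)) * (nnconv K ^^ k) f x" .
  qed auto
  finally show ?thesis .
qed

lemma nonlocal_solution_L1_bound:
  fixes J u :: "'a::euclidean_space \<Rightarrow> complex"
  assumes J [measurable]: "J \<in> borel_measurable borel" and u [measurable]: "u \<in> borel_measurable borel"
    and J_int: "(\<integral>\<^sup>+x. norm (J x) \<partial>lborel) = 1" and B: "\<And>x. norm (u x) \<le> B" and "0 \<le> t"
  shows "(\<integral>\<^sup>+x. norm (nonlocal_solution 1 J u t x) \<partial>lborel) \<le> (\<integral>\<^sup>+x. norm (u x) \<partial>lborel)"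
proof -
  let ?K = "\<lambda>x. ennreal (norm (J x))" and ?f = "\<lambda>x. ennreal (norm (u x))"
  let ?w = "\<lambda>k. exp (- t) * (t ^ k / fact k)"
  have w: "?w sums 1"
    using sums_mult[OF exp_converges[of t], of "exp (- t)"]
    by (simp add: divide_inverse mult_ac flip: exp_add)
  have "(\<integral>\<^sup>+x. norm (nonlocal_solution 1 J u t x) \<partial>lborel)
      \<le> (\<integral>\<^sup>+x. (\<Sum>k. ennreal (?w k) * (nnconv ?K ^^ k) ?f x) \<partial>lborel)"
    using assms by (intro nn_integral_mono norm_nonlocal_solution_le)
  also have "\<dots> = (\<Sum>k. \<integral>\<^sup>+x. ennreal (?w k) * (nnconv ?K ^^ k) ?f x \<partial>lborel)"
    by (rule nn_integral_suminf) measurable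
  also have "\<dots> = (\<Sum>k. ennreal (?w k) * (\<integral>\<^sup>+x. norm (u x) \<partial>lborel))"
    by (simp add: nn_integral_cmult nn_integral_nnconv_power J_int)
  also have "\<dots> = (\<Sum>k. ennreal (?w k)) * (\<integral>\<^sup>+x. norm (u x) \<partial>lborel)"
    by (rule ennreal_suminf_multc)
  also have "(\<Sum>k. ennreal (?w k)) = ennreal 1"
    using \<open>0 \<le> t\<close> by (intro suminf_ennreal_eq w) simp
  finally show ?thesis by simp
qed

text \<open>
  The constant has to be independent of the initial value, of \<open>t\<close> and of \<open>x\<close>; it is the one for the
  convolution powers of \<open>|J|\<close>, multiplied by the one for the Poisson average.
\<close>

lemma nonlocal_solution_sup_bound:
  fixes J :: "'a::euclidean_space \<Rightarrow> complex"
  assumes J [measurable]: "J \<in> borel_measurable borel"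
    and J_int: "(\<integral>\<^sup>+x. norm (J x) \<partial>lborel) = 1"
  shows "\<exists>C>0. \<forall>u B t x. u \<in> borel_measurable borel \<longrightarrow> (\<forall>x. norm (u x) \<le> B) \<longrightarrow> 0 < t \<longrightarrow>
    ennreal (norm (nonlocal_solution 1 J u t x))
      \<le> ennreal (C * (1 / sqrt t) ^ DIM('a)) * ((\<integral>\<^sup>+x. norm (u x) \<partial>lborel) + ennreal B)"
proof -
  let ?n = "DIM('a)"
  let ?K = "\<lambda>x. ennreal (norm (J x))"
  obtain C where C: "0 < C" "\<And>f B k x. f \<in> borel_measurable borel \<Longrightarrow> \<forall>x. f x \<le> B \<Longrightarrow>
      (nnconv ?K ^^ k) f x \<le> ennreal (C * sqrt_decay ?n k) * ((\<integral>\<^sup>+x. f x \<partial>lborel) + B)"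
    using nnconv_power_decay[of ?K] J_int by auto
  have "ennreal (norm (nonlocal_solution 1 J u t x))
      \<le> ennreal (C * ((fact ?n + 1) / 2) * (1 / sqrt t) ^ ?n) * ((\<integral>\<^sup>+x. norm (u x) \<partial>lborel) + ennreal B)"
    if u [measurable]: "u \<in> borel_measurable borel" and B: "\<forall>x. norm (u x) \<le> B" and "0 < t" for u B t x
  proof -
    let ?f = "\<lambda>x. ennreal (norm (u x))"
    let ?S = "(\<integral>\<^sup>+x. norm (u x) \<partial>lborel) + ennreal B"
    let ?w = "\<lambda>k. exp (- t) * (t ^ k / fact k)"
    have f_le: "\<forall>x. ?f x \<le> ennreal B" using B by (simp add: ennreal_leI)
    have "ennreal (norm (nonlocal_solution 1 J u t x)) \<le> (\<Sum>k. ennreal (?w k) * (nnconv ?K ^^ k) ?f x)"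
      using B \<open>0 < t\<close> by (intro norm_nonlocal_solution_le J u J_int) auto
    also have "\<dots> \<le> ennreal (C * ((fact ?n + 1) / 2) * (1 / sqrt t) ^ ?n) * ?S"
    proof (rule suminf_le_const)
      fix m
      have "(\<Sum>k<m. ennreal (?w k) * (nnconv ?K ^^ k) ?f x) \<le> (\<Sum>k<m. ennreal (C * (?w k * sqrt_decay ?n k)) * ?S)"
      proof (rule sum_mono)
        fix k
        have "ennreal (?w k) * (nnconv ?K ^^ k) ?f x \<le> ennreal (?w k) * (ennreal (C * sqrt_decay ?n k) * ?S)"
          by (intro mult_left_mono C(2) f_le) auto
        also have "\<dots> = ennreal (?w k * (C * sqrt_decay ?n k)) * ?S"
          using C(1) \<open>0 < t\<close> sqrt_decay_pos[of ?n k] by (subst ennreal_mult) (auto simp: mult.assoc)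
        also have "?w k * (C * sqrt_decay ?n k) = C * (?w k * sqrt_decay ?n k)" by simp
        finally show "ennreal (?w k) * (nnconv ?K ^^ k) ?f x \<le> ennreal (C * (?w k * sqrt_decay ?n k)) * ?S" .
      qed
      also have "\<dots> = ennreal (\<Sum>k<m. C * (?w k * sqrt_decay ?n k)) * ?S"
      proof -
        have "0 \<le> C * (?w k * sqrt_decay ?n k)" for k
          using C(1) \<open>0 < t\<close> sqrt_decay_pos[of ?n k] by simp
        then show ?thesis unfolding sum_distrib_right[symmetric] by (simp only: sum_ennreal)
      qed
      also have "\<dots> \<le> ennreal (C * ((fact ?n + 1) / 2) * (1 / sqrt t) ^ ?n) * ?S"
        unfolding sum_distrib_left[symmetric] mult.assoc[of C]
        using C(1) poisson_average_sqrt_decay_le[OF \<open>0 < t\<close>, of ?n m]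
        by (intro mult_right_mono ennreal_leI mult_left_mono) auto
      finally show "(\<Sum>k<m. ennreal (?w k) * (nnconv ?K ^^ k) ?f x)
         \<le> ennreal (C * ((fact ?n + 1) / 2) * (1 / sqrt t) ^ ?n) * ?S" .
    qed simp
    finally show ?thesis .
  qed
  moreover have "0 < C * ((fact ?n + 1) / 2)" using C(1) by (simp add: add_pos_pos)
  ultimately show ?thesis by blast
qed

section \<open>Interpolation between integrable and bounded functions\<close>

text \<open>
  From \<open>|v|\<^sup>q \<le> (D s)\<^sup>q\<^sup>-\<^sup>1 |v|\<close>. The supremum and the integral are bounded with the same \<open>D\<close>, in order that the
  constant be independent of \<open>q\<close>.
\<close>

lemma Lq_norm_interpolation:
  fixes v :: "'a \<Rightarrow> complex"
  assumes v [measurable]: "v \<in> borel_measurable M" and D: "0 < D" and s: "0 < s"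
    and sup: "AE x in M. norm (v x) \<le> D * s" and L1: "(\<integral>\<^sup>+x. norm (v x) \<partial>M) \<le> ennreal D"
    and q: "1 \<le> q"
  shows "Lq_norm M q v \<le> ennreal (D * s powr (1 - enn2real (1 / q)))"
proof (cases "q = \<infinity>")
  case True
  have "esssup M (\<lambda>x. ennreal (norm (v x))) \<le> ennreal (D * s)"
    using sup by (intro esssup_I) (auto intro: ennreal_leI)
  then show ?thesis using True s by (simp add: Lq_norm_def)
next
  case False
  define p where "p = enn2real q"
  have qp: "q = ennreal p" using False by (simp add: p_def less_top)
  have "1 \<le> p" using q unfolding qp by (metis ennreal_1 ennreal_le_iff2 not_one_le_zero zero_le_one)
  then have inv: "enn2real (1 / q) = 1 / p"
    unfolding qp by (simp add: divide_ennreal flip: ennreal_1)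
  let ?I = "\<integral>\<^sup>+x. ennreal (norm (v x) powr p) \<partial>M"
  have "?I \<le> (\<integral>\<^sup>+x. ennreal ((D * s) powr (p - 1)) * ennreal (norm (v x)) \<partial>M)"
  proof (rule nn_integral_mono_AE)
    show "AE x in M. ennreal (norm (v x) powr p) \<le> ennreal ((D * s) powr (p - 1)) * ennreal (norm (v x))"
      using sup
    proof eventually_elim
      fix x assume le: "norm (v x) \<le> D * s"
      have "norm (v x) powr p = norm (v x) powr (p - 1) * norm (v x)"
        using \<open>1 \<le> p\<close> by (cases "v x = 0") (simp_all add: powr_diff)
      also have "\<dots> \<le> (D * s) powr (p - 1) * norm (v x)"
        using le \<open>1 \<le> p\<close> by (intro mult_right_mono powr_mono2) auto
      finally show "ennreal (norm (v x) powr p) \<le> ennreal ((D * s) powr (p - 1)) * ennreal (norm (v x))"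
        by (simp add: ennreal_leI flip: ennreal_mult)
    qed
  qed
  also have "\<dots> = ennreal ((D * s) powr (p - 1)) * (\<integral>\<^sup>+x. norm (v x) \<partial>M)"
    by (rule nn_integral_cmult) measurable
  also have "\<dots> \<le> ennreal ((D * s) powr (p - 1)) * ennreal D"
    by (intro mult_left_mono L1) simp
  also have "\<dots> = ennreal (D powr p * s powr (p - 1))"
    using D s by (simp add: powr_mult powr_diff flip: ennreal_mult)
  finally have I_le: "?I \<le> ennreal (D powr p * s powr (p - 1))" .
  then have I_fin: "?I \<noteq> \<infinity>" by (auto simp: top_unique)
  have "enn2real ?I \<le> D powr p * s powr (p - 1)"
    using I_le by (intro enn2real_leI) auto
  then have "enn2real ?I powr (1 / p) \<le> (D powr p * s powr (p - 1)) powr (1 / p)"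
    using \<open>1 \<le> p\<close> by (intro powr_mono2) auto
  also have "\<dots> = D * s powr (1 - 1 / p)"
    using D s \<open>1 \<le> p\<close> by (simp add: powr_mult powr_powr diff_divide_distrib)
  finally show ?thesis
    using False v I_fin by (simp add: Lq_norm_def p_def[symmetric] inv Let_def ennreal_leI)
qed

lemma Lq_space_measurable: "f \<in> Lq_space M q \<Longrightarrow> f \<in> borel_measurable M"
  by (auto simp: Lq_space_def Lq_norm_def split: if_splits)

lemma Lq_space_1_finite:
  assumes "f \<in> Lq_space M 1"
  shows "(\<integral>\<^sup>+x. norm (f x) \<partial>M) < \<infinity>"
proof -
  have "(\<integral>\<^sup>+x. norm (f x) powr 1 \<partial>M) \<noteq> \<infinity>"
    using assms Lq_space_measurable[OF assms]
    by (auto simp: Lq_space_def Lq_norm_def Let_def split: if_splits)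
  then show ?thesis by (simp add: less_top)
qed

lemma Lq_space_infinity_AE_bounded:
  assumes "f \<in> Lq_space M \<infinity>"
  obtains B where "AE x in M. norm (f x) \<le> B"
proof -
  let ?s = "esssup M (\<lambda>x. ennreal (norm (f x)))"
  have "?s < top"
    using assms Lq_space_measurable[OF assms] by (simp add: Lq_space_def Lq_norm_def)
  have "AE x in M. norm (f x) \<le> enn2real ?s"
    using esssup_AE[where M=M and f="\<lambda>x. ennreal (norm (f x))"]
  proof eventually_elim
    fix x assume "ennreal (norm (f x)) \<le> ?s"
    then have "enn2real (ennreal (norm (f x))) \<le> enn2real ?s"
      using \<open>?s < top\<close> by (intro enn2real_mono)
    then show "norm (f x) \<le> enn2real ?s" by simp
  qed
  then show thesis by (rule that)
qed

section \<open>Decay of the solution\<close>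

theorem theorem4:
  fixes J u0 :: "real ^ 'n \<Rightarrow> complex" and \<epsilon>0 :: ennreal
  assumes "0 < \<epsilon>0"
    and "J \<in> Lq_space lebesgue 1 \<inter> Lq_space lebesgue (1 + \<epsilon>0)"
    and "(LINT x|lebesgue. norm (J x)) = 1"
    and "u0 \<in> Lq_space lebesgue 1 \<inter> Lq_space lebesgue \<infinity>"
  shows "\<exists>t0>0.
    (\<exists>C>0. \<forall>t\<ge>t0.
       Lq_norm lebesgue \<infinity> (nonlocal_solution 1 J u0 t)
         \<le> ennreal (C * t powr (- (real CARD('n) / 2)))) \<and>
    (\<exists>C>0. \<forall>q::ennreal. 1 \<le> q \<longrightarrow> (\<forall>t\<ge>t0.
       Lq_norm lebesgue q (nonlocal_solution 1 J u0 t)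
         \<le> ennreal (C * t powr (- (real CARD('n) / 2) * (1 - enn2real (1 / q))))))"
proof -
  let ?n = "CARD('n)"
  have J_meas: "J \<in> borel_measurable lebesgue" using assms(2) Lq_space_measurable by blast
  then obtain J' where J' [measurable]: "J' \<in> borel_measurable borel" and JJ': "AE x in lborel. J x = J' x"
    by (rule borel_representative_complex)
  have "integrable lebesgue (\<lambda>x. norm (J x))"
    using assms(3) not_integrable_integral_eq by fastforce
  then have "(\<integral>\<^sup>+x. norm (J x) \<partial>lebesgue) = 1"
    using assms(3) by (simp add: nn_integral_eq_integral)
  then have "(\<integral>\<^sup>+x. norm (J x) \<partial>lborel) = 1" by (simp only: nn_integral_completion)
  moreover have "(\<integral>\<^sup>+x. norm (J x) \<partial>lborel) = (\<integral>\<^sup>+x. norm (J' x) \<partial>lborel)"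
    using JJ' by (intro nn_integral_cong_AE) auto
  ultimately have J'_int: "(\<integral>\<^sup>+x. norm (J' x) \<partial>lborel) = 1" by simp

  have u0_meas: "u0 \<in> borel_measurable lebesgue" using assms(4) Lq_space_measurable by blast
  then obtain g where g [measurable]: "g \<in> borel_measurable borel" and u0g: "AE x in lborel. u0 x = g x"
    by (rule borel_representative_complex)
  obtain B0 where "AE x in lebesgue. norm (u0 x) \<le> B0"
    using assms(4) Lq_space_infinity_AE_bounded by blast
  then have B0: "AE x in lborel. norm (u0 x) \<le> B0" by (simp only: AE_completion_iff)
  define B where "B = max B0 0"
  \<comment> \<open>truncation turns the essential bound into a bound at every point\<close>
  define u' where "u' x = (if norm (g x) \<le> B then g x else 0)" for x
  have u' [measurable]: "u' \<in> borel_measurable borel" unfolding u'_def by measurable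
  have u'_le: "\<forall>x. norm (u' x) \<le> B" by (simp add: u'_def B_def)
  have u0u': "AE x in lborel. u0 x = u' x"
    using u0g B0 by eventually_elim (simp add: u'_def B_def)
  have "(\<integral>\<^sup>+x. norm (u' x) \<partial>lborel) = (\<integral>\<^sup>+x. norm (u0 x) \<partial>lborel)"
    using u0u' by (intro nn_integral_cong_AE) auto
  also have "\<dots> = (\<integral>\<^sup>+x. norm (u0 x) \<partial>lebesgue)" by (simp only: nn_integral_completion)
  also have "\<dots> < \<infinity>" using assms(4) Lq_space_1_finite by blast
  finally obtain I where I: "0 \<le> I" "(\<integral>\<^sup>+x. norm (u' x) \<partial>lborel) = ennreal I"
    by (cases "\<integral>\<^sup>+x. norm (u' x) \<partial>lborel") auto

  obtain C where C: "0 < C" "\<And>u B t x. u \<in> borel_measurable borel \<Longrightarrow> \<forall>x. norm (u x) \<le> B \<Longrightarrow> 0 < t \<Longrightarrow>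
    ennreal (norm (nonlocal_solution 1 J' u t x))
      \<le> ennreal (C * (1 / sqrt t) ^ DIM(real ^ 'n)) * ((\<integral>\<^sup>+x. norm (u x) \<partial>lborel) + ennreal B)"
    using nonlocal_solution_sup_bound[OF J' J'_int] by metis
  \<comment> \<open>one constant that dominates the \<open>L\<^sup>1\<close> norm and the factor in the supremum bound\<close>
  define D where "D = max 1 (max I (C * (I + B)))"
  have D: "1 \<le> D" "I \<le> D" "C * (I + B) \<le> D" unfolding D_def by linarith+
  then have "0 < D" by linarith
  have bound: "Lq_norm lebesgue q (nonlocal_solution 1 J u0 t)
      \<le> ennreal (D * t powr (- (real ?n / 2) * (1 - enn2real (1 / q))))"
    if "1 \<le> q" "1 \<le> t" for q t
  proof -
    let ?v = "nonlocal_solution 1 J u0 t" and ?v' = "nonlocal_solution 1 J' u' t"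
    define s where "s = t powr (- (real ?n / 2))"
    have "0 < s" using \<open>1 \<le> t\<close> by (simp add: s_def)
    have "1 / sqrt t = t powr (- (1 / 2))"
      using powr_half_sqrt[of t] \<open>1 \<le> t\<close> by (simp only: powr_minus_divide)
    then have "(1 / sqrt t) ^ ?n = (t powr (- (1 / 2))) powr real ?n"
      using \<open>1 \<le> t\<close> by (subst powr_realpow) auto
    then have s_eq: "(1 / sqrt t) ^ ?n = s" by (simp add: s_def powr_powr)
    have vv': "AE x in lborel. ?v' x = ?v x"
      using nonlocal_solution_cong_AE[OF J' u' JJ' u0u', of 1 t] by eventually_elim simp
    have v'_meas: "?v' \<in> borel_measurable borel" by (intro nonlocal_solution_measurable J' u')
    have v_meas: "?v \<in> borel_measurable lebesgue"
      using v'_meas by (intro borel_measurable_AE[OF _ AE_completion[OF vv']] measurable_completion) simp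
    have v'_le: "norm (?v' x) \<le> D * s" for x
    proof -
      have "ennreal (norm (?v' x)) \<le> ennreal (C * s) * (ennreal I + ennreal B)"
        using C(2)[OF u' u'_le, of t x] \<open>1 \<le> t\<close> by (simp add: I s_eq)
      also have "\<dots> = ennreal (C * (I + B) * s)"
        using C(1) I(1) \<open>0 < s\<close> by (simp add: B_def mult_ac flip: ennreal_plus ennreal_mult)
      also have "\<dots> \<le> ennreal (D * s)"
        using D(3) \<open>0 < s\<close> by (intro ennreal_leI mult_right_mono) auto
      finally show ?thesis using D(1) \<open>0 < s\<close> by simp
    qed
    have "AE x in lborel. norm (?v x) \<le> D * s"
      using vv' by eventually_elim (metis v'_le)
    then have sup: "AE x in lebesgue. norm (?v x) \<le> D * s" by (rule AE_completion)
    have "(\<integral>\<^sup>+x. norm (?v x) \<partial>lebesgue) = (\<integral>\<^sup>+x. norm (?v x) \<partial>lborel)"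
      by (rule nn_integral_completion)
    also have "\<dots> = (\<integral>\<^sup>+x. norm (?v' x) \<partial>lborel)"
      using vv' by (intro nn_integral_cong_AE) auto
    also have "\<dots> \<le> ennreal I"
      unfolding I(2)[symmetric] using u'_le \<open>1 \<le> t\<close> by (intro nonlocal_solution_L1_bound J' u' J'_int) auto
    also have "\<dots> \<le> ennreal D" by (rule ennreal_leI[OF D(2)])
    finally have "(\<integral>\<^sup>+x. norm (?v x) \<partial>lebesgue) \<le> ennreal D" .
    from Lq_norm_interpolation[OF v_meas \<open>0 < D\<close> \<open>0 < s\<close> sup this \<open>1 \<le> q\<close>]
    show ?thesis by (simp add: s_def powr_powr)
  qed
  have sup_bound: "Lq_norm lebesgue \<infinity> (nonlocal_solution 1 J u0 t) \<le> ennreal (D * t powr (- (real ?n / 2)))"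
    if "1 \<le> t" for t
    using bound[of \<infinity> t] that by simp
  show ?thesis
  proof (rule exI[of _ "1::real"], intro conjI)
    show "\<exists>C>0. \<forall>t\<ge>1. Lq_norm lebesgue \<infinity> (nonlocal_solution 1 J u0 t)
        \<le> ennreal (C * t powr (- (real ?n / 2)))"
      using sup_bound D(1) by (intro exI[of _ D]) auto
    show "\<exists>C>0. \<forall>q::ennreal. 1 \<le> q \<longrightarrow> (\<forall>t\<ge>1. Lq_norm lebesgue q (nonlocal_solution 1 J u0 t)
        \<le> ennreal (C * t powr (- (real ?n / 2) * (1 - enn2real (1 / q)))))"
      using bound D(1) by (intro exI[of _ D]) auto
  qed simp
qed

end
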